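(* Let $(G,M,\Delta)$ be a Garside structure on a group $G$ and let $(H,N,\Lambda)$ and $(G_1,M_1,\Delta_1)$ be two parabolic substructures such that $N\neq M$, $M_1\ne M$, $N\cup M_1$ generates $M$, $\Delta$ is central in $G$, and $\Delta_1$ is central in $G_1$. If there exists an integer $\zeta\ge 1$ such that $(H,G_1)$ satisfies Condition A with constant $\zeta$ and Condition B with constant $\zeta$, then $(H,G_1)$ is a Dehornoy structure.
   Context: Garside structures. Let $G$ be a group and $M$ a submonoid with $M\cap M^{-1}=\{1\}$. For $\alpha,\beta\in G$: $\alpha\le_R\beta$ iff $\beta\alpha^{-1}\in M$, and $\alpha\le_L\beta$ iff $\alpha^{-1}\beta\in M$. An element $a\in M$ is balanced if $\{b\in M\mid b\le_R a\}=\{b\in M\mid b\le_L a\}$; this set is then denoted $\mathrm{Div}(a)$. For a balanced $\Delta\in M$, $(G,M,\Delta)$ is a Garside structure if: (a) $M$ is Noetherian, i.e. for each $a\in M$ there is $n\ge1$ such that $a$ is not a product of more than $n$ non-trivial elements of $M$; (b) $\mathrm{Div}(\Delta)$ is finite, generates $M$ as a monoid and $G$ as a group; (c) $(G,\le_R)$ is a lattice. An element $a\in M$ is unmovable if $\Delta\not\le_R a$. Every $\alpha\in G$ is uniquely $\alpha=a\Delta^k$ with $a\in M$ unmovable and $k\in\mathbb Z$ (the $\Delta$-form of $\alpha$). If $\delta\in M$ is balanced and $G_\delta$, $M_\delta$ are the subgroup of $G$ and the submonoid of $M$ generated by $\mathrm{Div}(\delta)$, then $(G_\delta,M_\delta,\delta)$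 is a parabolic substructure if $\mathrm{Div}(\delta)=\mathrm{Div}(\Delta)\cap M_\delta$; then $M_\delta$ is called a parabolic submonoid. Depth. For a parabolic submonoid $K$ and $a\in M$, $\tau_K(a)$ denotes the unique $b\in K$ with $\{c\in K\mid c\le_R a\}=\{c\in K\mid c\le_R b\}$. Every $a\in M\setminus\{1\}$ is uniquely $a=a_p\cdots a_2a_1$ with $a_p\ne1$, $a_i=\tau_{M_1}(a_p\cdots a_i)$ for $i$ odd and $a_i=\tau_N(a_p\cdots a_i)$ for $i$ even; set $\mathrm{bh}(a)=p$ and $\mathrm{bh}(1)=1$. The depth is $\mathrm{dpt}(a)=(\mathrm{bh}(a)-1)/2$ if $\mathrm{bh}(a)$ is odd and $\mathrm{bh}(a)/2$ if $\mathrm{bh}(a)$ is even. Dehornoy structure. An element $\alpha\in G$ with $\Delta$-form $\alpha=a\Delta^{-k}$ is $(H,G_1)$-negative if $k\ge1$ and $\mathrm{dpt}(a)<\mathrm{dpt}(\Delta^k)$; $\alpha$ is $(H,G_1)$-positive if $\alpha^{-1}$ is $(H,G_1)$-negative. Let $P$ be the set of $(H,G_1)$-positive elements; $P^{-1}$ is then the set of $(H,G_1)$-negative elements. The pair $(H,G_1)$ is a Dehornoy structure if (a) $PP\subset P$, (b) $G_1PG_1\subset P$, (c) $G=P\sqcup P^{-1}\sqcup G_1$ (disjoint union). Conditions A and B. Condition A with constant $\zeta$: $\mathrm{dpt}(\Delta^k)=\zeta k+1$ for all $k\ge1$. Set $\theta=\Delta\Delta_1^{-1}=\Delta_1^{-1}\Delta\in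 M$, $\Theta=\{\theta^ka_0\mid k\ge1,\ a_0\in M_1\}$ and $\bar\Theta=\Theta\cup M_1$. Condition B with constant $\zeta$: for every $(a,b)\in(M\times M)\setminus(\bar\Theta\times\bar\Theta)$ with $a,b$ both unmovable, writing $ab=c\Delta^t$ for the $\Delta$-form of $ab$, there exists $\varepsilon\in\{0,1\}$ such that $\mathrm{dpt}(c)=\mathrm{dpt}(a)+\mathrm{dpt}(b)-\zeta t-\varepsilon$, and $\varepsilon=1$ if either $a\in\Theta$, or $b\in\Theta$, or $c\in M_1$. *)

theory Defs
  imports "HOL-Algebra.Algebra"
begin

section \<open>Garside structures\<close>

definition le_R :: "('a, 'b) monoid_scheme \<Rightarrow> 'a set \<Rightarrow> 'a \<Rightarrow> 'a \<Rightarrow> bool" where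
  "le_R G M \<alpha> \<beta> \<longleftrightarrow> \<beta> \<otimes>\<^bsub>G\<^esub> inv\<^bsub>G\<^esub> \<alpha> \<in> M"

definition le_L :: "('a, 'b) monoid_scheme \<Rightarrow> 'a set \<Rightarrow> 'a \<Rightarrow> 'a \<Rightarrow> bool" where
  "le_L G M \<alpha> \<beta> \<longleftrightarrow> inv\<^bsub>G\<^esub> \<alpha> \<otimes>\<^bsub>G\<^esub> \<beta> \<in> M"

definition balanced :: "('a, 'b) monoid_scheme \<Rightarrow> 'a set \<Rightarrow> 'a \<Rightarrow> bool" where
  "balanced G M a \<longleftrightarrow> a \<in> M \<and> {b \<in> M. le_R G M b a} = {b \<in> M. le_L G M b a}"

definition Div :: "('a, 'b) monoid_scheme \<Rightarrow> 'a set \<Rightarrow> 'a \<Rightarrow> 'a set" where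
  "Div G M a = {b \<in> M. le_R G M b a}"

definition monoid_span :: "('a, 'b) monoid_scheme \<Rightarrow> 'a set \<Rightarrow> 'a set" where
  "monoid_span G S = (\<lambda>K. submonoid K G) hull S"

definition word_prod :: "('a, 'b) monoid_scheme \<Rightarrow> 'a list \<Rightarrow> 'a" where
  "word_prod G w = foldr (\<otimes>\<^bsub>G\<^esub>) w \<one>\<^bsub>G\<^esub>"

definition noetherian_submonoid :: "('a, 'b) monoid_scheme \<Rightarrow> 'a set \<Rightarrow> bool" where
  "noetherian_submonoid G M \<longleftrightarrow>
     (\<forall>a\<in>M. \<exists>n\<ge>1. \<forall>w. set w \<subseteq> M - {\<one>\<^bsub>G\<^esub>} \<and> word_prod G w = a \<longrightarrow> length w \<le> n)"

definition R_order :: "('a, 'b) monoid_scheme \<Rightarrow> 'a set \<Rightarrow> 'a gorder" where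
  "R_order G M = \<lparr>carrier = carrier G, eq = (=), le = le_R G M\<rparr>"

locale garside_structure = group G + submonoid M G
  for G (structure) and M +
  fixes \<Delta>
  assumes pointed: "M \<inter> set_inv M = {\<one>}"
    and balanced_Delta: "balanced G M \<Delta>"
    and noetherian: "noetherian_submonoid G M"
    and finite_Div: "finite (Div G M \<Delta>)"
    and Div_generates_monoid: "monoid_span G (Div G M \<Delta>) = M"
    and Div_generates_group: "generate G (Div G M \<Delta>) = carrier G"
    and lattice_R: "lattice (R_order G M)"

definition unmovable :: "('a, 'b) monoid_scheme \<Rightarrow> 'a set \<Rightarrow> 'a \<Rightarrow> 'a \<Rightarrow> bool" where
  "unmovable G M \<Delta> a \<longleftrightarrow> a \<in> M \<and> \<not> le_R G M \<Delta> a"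

text \<open>\<open>is_Delta_form G M \<Delta> \<alpha> a k\<close>: the (unique) \<open>\<Delta>\<close>-form of \<open>\<alpha>\<close> is \<open>a \<Delta>\<^sup>k\<close>.\<close>

definition is_Delta_form ::
    "('a, 'b) monoid_scheme \<Rightarrow> 'a set \<Rightarrow> 'a \<Rightarrow> 'a \<Rightarrow> 'a \<Rightarrow> int \<Rightarrow> bool" where
  "is_Delta_form G M \<Delta> \<alpha> a k \<longleftrightarrow>
     unmovable G M \<Delta> a \<and> \<alpha> = a \<otimes>\<^bsub>G\<^esub> (\<Delta> [^]\<^bsub>G\<^esub> k)"

definition parabolic_substructure ::
    "('a, 'b) monoid_scheme \<Rightarrow> 'a set \<Rightarrow> 'a \<Rightarrow> 'a set \<Rightarrow> 'a set \<Rightarrow> 'a \<Rightarrow> bool" where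
  "parabolic_substructure G M \<Delta> H N \<delta> \<longleftrightarrow>
     balanced G M \<delta> \<and>
     H = generate G (Div G M \<delta>) \<and>
     N = monoid_span G (Div G M \<delta>) \<and>
     Div G M \<delta> = Div G M \<Delta> \<inter> N"

section \<open>Depth\<close>

definition tail :: "('a, 'b) monoid_scheme \<Rightarrow> 'a set \<Rightarrow> 'a set \<Rightarrow> 'a \<Rightarrow> 'a" where
  "tail G M K a =
     (THE b. b \<in> K \<and> {c \<in> K. le_R G M c a} = {c \<in> K. le_R G M c b})"

text \<open>The word \<open>w = [a\<^sub>p, \<dots>, a\<^sub>1]\<close> lists the factors from left to right, so that
  \<open>a\<^sub>i = w ! (p - i)\<close> and \<open>a\<^sub>p \<dots> a\<^sub>i\<close> is the product of the first \<open>p - i + 1\<close> letters.\<close>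

definition is_alternating_form ::
    "('a, 'b) monoid_scheme \<Rightarrow> 'a set \<Rightarrow> 'a set \<Rightarrow> 'a set \<Rightarrow> 'a \<Rightarrow> 'a list \<Rightarrow> bool" where
  "is_alternating_form G M N M\<^sub>1 a w \<longleftrightarrow>
     w \<noteq> [] \<and> set w \<subseteq> M \<and> word_prod G w = a \<and> hd w \<noteq> \<one>\<^bsub>G\<^esub> \<and>
     (\<forall>i\<in>{1..length w}. w ! (length w - i) =
        tail G M (if odd i then M\<^sub>1 else N) (word_prod G (take (length w - i + 1) w)))"

definition breadth ::
    "('a, 'b) monoid_scheme \<Rightarrow> 'a set \<Rightarrow> 'a set \<Rightarrow> 'a set \<Rightarrow> 'a \<Rightarrow> nat" where
  "breadth G M N M\<^sub>1 a =
     (if a = \<one>\<^bsub>G\<^esub> then 1 else length (THE w. is_alternating_form G M N M\<^sub>1 a w))"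

definition depth ::
    "('a, 'b) monoid_scheme \<Rightarrow> 'a set \<Rightarrow> 'a set \<Rightarrow> 'a set \<Rightarrow> 'a \<Rightarrow> nat" where
  "depth G M N M\<^sub>1 a =
     (if odd (breadth G M N M\<^sub>1 a) then (breadth G M N M\<^sub>1 a - 1) div 2
      else breadth G M N M\<^sub>1 a div 2)"

section \<open>Dehornoy structures\<close>

text \<open>\<open>(H, G\<^sub>1)\<close>-negativity refers to the pair of parabolic subgroups only through the
  parabolic submonoids \<open>N\<close> and \<open>M\<^sub>1\<close>, on which the depth depends.\<close>

definition negative ::
    "('a, 'b) monoid_scheme \<Rightarrow> 'a set \<Rightarrow> 'a \<Rightarrow> 'a set \<Rightarrow> 'a set \<Rightarrow> 'a \<Rightarrow> bool" where
  "negative G M \<Delta> N M\<^sub>1 \<alpha> \<longleftrightarrow>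
     (\<exists>a k. is_Delta_form G M \<Delta> \<alpha> a (- k) \<and> k \<ge> 1 \<and>
        depth G M N M\<^sub>1 a < depth G M N M\<^sub>1 (\<Delta> [^]\<^bsub>G\<^esub> k))"

definition positives ::
    "('a, 'b) monoid_scheme \<Rightarrow> 'a set \<Rightarrow> 'a \<Rightarrow> 'a set \<Rightarrow> 'a set \<Rightarrow> 'a set" where
  "positives G M \<Delta> N M\<^sub>1 = {\<alpha> \<in> carrier G. negative G M \<Delta> N M\<^sub>1 (inv\<^bsub>G\<^esub> \<alpha>)}"

definition dehornoy_structure ::
    "('a, 'b) monoid_scheme \<Rightarrow> 'a set \<Rightarrow> 'a \<Rightarrow> 'a set \<Rightarrow> 'a set \<Rightarrow> 'a set \<Rightarrow> bool" where
  "dehornoy_structure G M \<Delta> N G\<^sub>1 M\<^sub>1 \<longleftrightarrow>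
     (let P = positives G M \<Delta> N M\<^sub>1 in
        P <#>\<^bsub>G\<^esub> P \<subseteq> P \<and>
        G\<^sub>1 <#>\<^bsub>G\<^esub> P <#>\<^bsub>G\<^esub> G\<^sub>1 \<subseteq> P \<and>
        carrier G = P \<union> set_inv\<^bsub>G\<^esub> P \<union> G\<^sub>1 \<and>
        P \<inter> set_inv\<^bsub>G\<^esub> P = {} \<and> P \<inter> G\<^sub>1 = {} \<and> set_inv\<^bsub>G\<^esub> P \<inter> G\<^sub>1 = {})"

section \<open>Conditions A and B\<close>

definition condition_A ::
    "('a, 'b) monoid_scheme \<Rightarrow> 'a set \<Rightarrow> 'a \<Rightarrow> 'a set \<Rightarrow> 'a set \<Rightarrow> int \<Rightarrow> bool" where
  "condition_A G M \<Delta> N M\<^sub>1 \<zeta> \<longleftrightarrow>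
     (\<forall>k::int. k \<ge> 1 \<longrightarrow> int (depth G M N M\<^sub>1 (\<Delta> [^]\<^bsub>G\<^esub> k)) = \<zeta> * k + 1)"

definition Theta ::
    "('a, 'b) monoid_scheme \<Rightarrow> 'a \<Rightarrow> 'a set \<Rightarrow> 'a \<Rightarrow> 'a set" where
  "Theta G \<Delta> M\<^sub>1 \<Delta>\<^sub>1 =
     {((\<Delta> \<otimes>\<^bsub>G\<^esub> inv\<^bsub>G\<^esub> \<Delta>\<^sub>1) [^]\<^bsub>G\<^esub> k) \<otimes>\<^bsub>G\<^esub> a\<^sub>0 | k a\<^sub>0. (k::int) \<ge> 1 \<and> a\<^sub>0 \<in> M\<^sub>1}"

definition Theta_bar ::
    "('a, 'b) monoid_scheme \<Rightarrow> 'a \<Rightarrow> 'a set \<Rightarrow> 'a \<Rightarrow> 'a set" where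
  "Theta_bar G \<Delta> M\<^sub>1 \<Delta>\<^sub>1 = Theta G \<Delta> M\<^sub>1 \<Delta>\<^sub>1 \<union> M\<^sub>1"

definition condition_B ::
    "('a, 'b) monoid_scheme \<Rightarrow> 'a set \<Rightarrow> 'a \<Rightarrow> 'a set \<Rightarrow> 'a set \<Rightarrow> 'a \<Rightarrow> int \<Rightarrow> bool" where
  "condition_B G M \<Delta> N M\<^sub>1 \<Delta>\<^sub>1 \<zeta> \<longleftrightarrow>
     (\<forall>(a, b) \<in> M \<times> M - Theta_bar G \<Delta> M\<^sub>1 \<Delta>\<^sub>1 \<times> Theta_bar G \<Delta> M\<^sub>1 \<Delta>\<^sub>1.
        unmovable G M \<Delta> a \<and> unmovable G M \<Delta> b \<longrightarrow>
        (\<forall>c t. is_Delta_form G M \<Delta> (a \<otimes>\<^bsub>G\<^esub> b) c t \<longrightarrow>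
           (\<exists>\<epsilon>\<in>{0, 1::int}.
              int (depth G M N M\<^sub>1 c) =
                int (depth G M N M\<^sub>1 a) + int (depth G M N M\<^sub>1 b) - \<zeta> * t - \<epsilon> \<and>
              (a \<in> Theta G \<Delta> M\<^sub>1 \<Delta>\<^sub>1 \<or> b \<in> Theta G \<Delta> M\<^sub>1 \<Delta>\<^sub>1 \<or> c \<in> M\<^sub>1 \<longrightarrow> \<epsilon> = 1))))"

end

theory Submission
  imports Defs
begin

text \<open>
  A parabolic submonoid is closed under factor_closed and lcms, so tails and alternating forms exist,
  \<open>dpt a = 0\<close> means \<open>a \<in> M\<^sub>1\<close>, and the depth is invariant under right multiplication by \<open>M\<^sub>1\<close>.
  By Condition A an element with \<open>\<Delta>\<close>-form \<open>a \<Delta>\<^sup>p\<close> is negative iff \<open>p \<le> -1\<close> and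
  \<open>dpt a \<le> - \<zeta> p\<close>. Elements \<open>\<gamma> \<Delta>\<^sup>j\<close> with \<open>\<gamma> \<in> G\<^sub>1\<close> are treated directly: the \<open>\<Delta>\<close>-form of
  \<open>\<gamma>\<close> is \<open>\<theta>\<^sup>m c \<Delta>\<^sup>-\<^sup>m\<close> with \<open>c \<in> M\<^sub>1\<close>, and such an element is negative iff \<open>j < 0\<close>. In every other
  case Condition B applies: to \<open>\<alpha>\<close> and its inverse it yields the trichotomy, and to two factor_closed it
  yields the closure properties.
\<close>

section \<open>Divisibility in a Garside monoid\<close>

lemma (in monoid) monoid_span_submonoid:
  assumes "S \<subseteq> carrier G"
  shows "submonoid (monoid_span G S) G"
proof
  show "monoid_span G S \<subseteq> carrier G"
    using assms unfolding monoid_span_def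
    by (intro hull_minimal) (auto intro: submonoid.intro)
qed (auto simp: monoid_span_def hull_def submonoid.m_closed submonoid.one_closed)

lemma (in monoid) monoid_span_induct_right [consumes 2, case_names one mult]:
  assumes "a \<in> monoid_span G S" "S \<subseteq> carrier G"
    and one: "P \<one>"
    and mult: "\<And>a s. a \<in> monoid_span G S \<Longrightarrow> s \<in> S \<Longrightarrow> P a \<Longrightarrow> P (a \<otimes> s)"
  shows "P a"
proof -
  interpret K: submonoid "monoid_span G S" G
    by (rule monoid_span_submonoid) fact
  \<comment> \<open>The hull carries no direction of multiplication. The elements whose right
    multiplication preserves \<open>P\<close> form a submonoid containing \<open>S\<close>, hence
    everything spanned by \<open>S\<close>; applying them to the unit gives the claim.\<close>
  define T where "T = {b \<in> monoid_span G S. \<forall>a \<in> monoid_span G S. P a \<longrightarrow> P (a \<otimes> b)}"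
  have "submonoid T G"
    by standard (auto simp: T_def m_assoc[symmetric])
  moreover have "S \<subseteq> T"
    using mult by (auto simp: T_def monoid_span_def hull_inc)
  ultimately have "monoid_span G S \<subseteq> T"
    unfolding monoid_span_def by (intro hull_minimal)
  then have "\<forall>b \<in> monoid_span G S. P b \<longrightarrow> P (b \<otimes> a)"
    using assms(1) by (auto simp: T_def)
  from this[rule_format, OF K.one_closed one] show ?thesis
    using assms(1) by simp
qed

lemma (in monoid) monoid_span_subset:
  assumes "submonoid K G" "S \<subseteq> K"
  shows "monoid_span G S \<subseteq> K"
  using assms unfolding monoid_span_def by (intro hull_minimal)

lemma word_prod_Nil [simp]: "word_prod G [] = \<one>\<^bsub>G\<^esub>"
  and word_prod_Cons [simp]: "word_prod G (x # w) = x \<otimes>\<^bsub>G\<^esub> word_prod G w"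
  by (simp_all add: word_prod_def)

lemma (in submonoid) word_prod_closed: "set w \<subseteq> H \<Longrightarrow> word_prod G w \<in> H"
  by (induction w) auto

lemma (in monoid) word_prod_append:
  assumes "set v \<subseteq> carrier G" "set w \<subseteq> carrier G"
  shows "word_prod G (v @ w) = word_prod G v \<otimes> word_prod G w"
proof -
  interpret C: submonoid "carrier G" G by standard auto
  show ?thesis
    using assms by (induction v) (auto simp: m_assoc C.word_prod_closed)
qed

context garside_structure
begin

section \<open>Right divisibility and least common multiples\<close>

abbreviation rdvd (infix "\<preceq>" 50) where "a \<preceq> b \<equiv> le_R G M a b"

lemma rdvdE:
  assumes "a \<preceq> b" "a \<in> carrier G" "b \<in> carrier G"
  obtains x where "x \<in> M" "b = x \<otimes> a"
proof
  show "b \<otimes> inv a \<in> M" using assms by (simp add: le_R_def)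
  show "b = b \<otimes> inv a \<otimes> a" using assms by (simp add: m_assoc)
qed

lemma rdvd_mult [simp]:
  "x \<in> M \<Longrightarrow> a \<in> carrier G \<Longrightarrow> a \<preceq> x \<otimes> a"
  by (simp add: le_R_def m_assoc)

lemma rdvd_refl [simp]: "a \<in> carrier G \<Longrightarrow> a \<preceq> a"
  by (simp add: le_R_def)

lemma rdvd_trans:
  assumes "a \<preceq> b" "b \<preceq> c" "a \<in> carrier G" "b \<in> carrier G" "c \<in> carrier G"
  shows "a \<preceq> c"
proof -
  obtain x y where "x \<in> M" "y \<in> M" "b = x \<otimes> a" "c = y \<otimes> b"
    using assms by (metis rdvdE)
  then have "c = (y \<otimes> x) \<otimes> a" using assms by (simp add: m_assoc)
  then show ?thesis using \<open>x \<in> M\<close> \<open>y \<in> M\<close> assms by simp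
qed

lemma rdvd_mult_cancel [simp]:
  assumes "a \<in> carrier G" "b \<in> carrier G" "c \<in> carrier G"
  shows "a \<otimes> c \<preceq> b \<otimes> c \<longleftrightarrow> a \<preceq> b"
proof -
  have "c \<otimes> (inv c \<otimes> inv a) = inv a"
    using assms by (simp add: m_assoc[symmetric])
  then have "b \<otimes> c \<otimes> inv (a \<otimes> c) = b \<otimes> inv a"
    using assms by (simp add: inv_mult_group m_assoc)
  then show ?thesis using assms by (simp add: le_R_def)
qed

lemma mult_eq_one:
  assumes "x \<in> M" "y \<in> M" "x \<otimes> y = \<one>"
  shows "x = \<one>" "y = \<one>"
proof -
  have "y = inv x" using assms by (metis inv_comm inv_equality mem_carrier)
  then have "y \<in> M \<inter> set_inv M" using assms by (auto simp: SET_INV_def)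
  then show "y = \<one>" using pointed by blast
  then show "x = \<one>" using assms by simp
qed

lemma rdvd_antisym:
  assumes "a \<preceq> b" "b \<preceq> a" "a \<in> carrier G" "b \<in> carrier G"
  shows "a = b"
proof -
  obtain x y where xy: "x \<in> M" "y \<in> M" "b = x \<otimes> a" "a = y \<otimes> b"
    using assms by (metis rdvdE)
  then have "(y \<otimes> x) \<otimes> a = a" using assms by (simp add: m_assoc)
  then have "y \<otimes> x = \<one>" using xy assms by (metis mem_carrier m_closed r_cancel_one)
  then have "x = \<one>" using mult_eq_one xy by metis
  then show ?thesis using xy(3) assms by simp
qed

lemma rdvd_one: "a \<in> M \<Longrightarrow> a \<preceq> \<one> \<Longrightarrow> a = \<one>"
  by (rule rdvd_antisym) (auto simp: le_R_def)

text \<open>The join in the lattice on the whole group lies above \<open>a\<close> and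
  \<open>b\<close>, so both cofactors are in \<open>M\<close>. Minimality holds against every upper
  bound in the group.\<close>

lemma rdvd_lcm:
  assumes "a \<in> M" "b \<in> M"
  obtains x y where "x \<in> M" "y \<in> M" "x \<otimes> a = y \<otimes> b"
    "\<And>u. u \<in> carrier G \<Longrightarrow> a \<preceq> u \<Longrightarrow> b \<preceq> u \<Longrightarrow> x \<otimes> a \<preceq> u"
proof -
  interpret L: lattice "R_order G M" by (rule lattice_R)
  define j where "j = join (R_order G M) a b"
  have ab: "a \<in> carrier (R_order G M)" "b \<in> carrier (R_order G M)"
    using assms by (auto simp: R_order_def)
  have j: "j \<in> carrier G" "a \<preceq> j" "b \<preceq> j"
    using L.join_closed[OF ab] L.join_left[OF ab] L.join_right[OF ab]
    by (auto simp: j_def R_order_def)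
  then obtain x y where "x \<in> M" "y \<in> M" "j = x \<otimes> a" "j = y \<otimes> b"
    using assms by (metis rdvdE mem_carrier)
  moreover have "j \<preceq> u" if "u \<in> carrier G" "a \<preceq> u" "b \<preceq> u" for u
    using L.join_le[of a u b] ab that by (auto simp: j_def R_order_def)
  ultimately show ?thesis using that by metis
qed

section \<open>Length of a longest factorization\<close>

definition max_length :: "'a \<Rightarrow> nat" where
  "max_length a = (GREATEST n. \<exists>w. set w \<subseteq> M - {\<one>} \<and> word_prod G w = a \<and> length w = n)"

lemma length_le_max_length:
  assumes "set w \<subseteq> M - {\<one>}" "word_prod G w = a"
  shows "length w \<le> max_length a"
proof -
  have "a \<in> M" using assms word_prod_closed by blast
  then obtain n where "\<forall>w. set w \<subseteq> M - {\<one>} \<and> word_prod G w = a \<longrightarrow> length w \<le> n"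
    using noetherian unfolding noetherian_submonoid_def by blast
  then show ?thesis unfolding max_length_def using assms
    by (intro Greatest_le_nat[where b = n]) auto
qed

lemma max_length_word:
  assumes "a \<in> M"
  obtains w where "set w \<subseteq> M - {\<one>}" "word_prod G w = a" "length w = max_length a"
proof -
  obtain n where n: "\<forall>w. set w \<subseteq> M - {\<one>} \<and> word_prod G w = a \<longrightarrow> length w \<le> n"
    using assms noetherian unfolding noetherian_submonoid_def by blast
  define Q where "Q = (\<lambda>n. \<exists>w. set w \<subseteq> M - {\<one>} \<and> word_prod G w = a \<and> length w = n)"
  \<comment> \<open>A witness that some length occurs, so that the greatest one is meaningful; the
    unit needs the empty word because letters differ from \<open>\<one>\<close>.\<close>
  define w where "w = (if a = \<one> then [] else [a])"
  have "set w \<subseteq> M - {\<one>}" "word_prod G w = a" using assms by (auto simp: w_def)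
  then have "Q (length w)" unfolding Q_def by blast
  moreover have "\<And>k. Q k \<Longrightarrow> k \<le> n" using n by (auto simp: Q_def)
  ultimately have "Q (max_length a)"
    unfolding max_length_def Q_def[symmetric] by (rule GreatestI_nat)
  then show ?thesis using that by (auto simp: Q_def)
qed

lemma max_length_mult_ge:
  assumes "a \<in> M" "b \<in> M"
  shows "max_length a + max_length b \<le> max_length (a \<otimes> b)"
proof -
  obtain v w where "set v \<subseteq> M - {\<one>}" "word_prod G v = a" "length v = max_length a"
    "set w \<subseteq> M - {\<one>}" "word_prod G w = b" "length w = max_length b"
    using max_length_word assms by metis
  then show ?thesis
    using length_le_max_length[of "v @ w" "a \<otimes> b"] word_prod_append[of v w] subset by auto
qed

lemma max_length_pos: "a \<in> M \<Longrightarrow> a \<noteq> \<one> \<Longrightarrow> 0 < max_length a"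
  using length_le_max_length[of "[a]" a] by auto

text \<open>Stripping a nontrivial factor from either side lowers \<open>max_length\<close>, which
  makes it the measure for the inductions on elements of \<open>M\<close>.\<close>

lemma max_length_less_mult:
  assumes "a \<in> M" "b \<in> M" "b \<noteq> \<one>"
  shows "max_length a < max_length (a \<otimes> b)" "max_length a < max_length (b \<otimes> a)"
  using max_length_mult_ge[of a b] max_length_mult_ge[of b a] max_length_pos[of b] assms by auto

section \<open>Divisors of a balanced element\<close>

lemma Div_iff_left: "d \<in> M \<Longrightarrow> x \<in> Div G M d \<longleftrightarrow> x \<in> M \<and> (\<exists>y\<in>M. d = y \<otimes> x)"
  by (auto simp: Div_def elim!: rdvdE)

lemma Div_iff_right:
  assumes "balanced G M d"
  shows "x \<in> Div G M d \<longleftrightarrow> x \<in> M \<and> (\<exists>y\<in>M. d = x \<otimes> y)"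
proof -
  have d: "d \<in> M" "Div G M d = {b \<in> M. le_L G M b d}"
    using assms by (auto simp: balanced_def Div_def)
  have "inv x \<otimes> d \<in> M \<longleftrightarrow> (\<exists>y\<in>M. d = x \<otimes> y)" if "x \<in> M"
    using that d(1) by (metis inv_solve_left inv_closed mem_carrier)
  then show ?thesis using d by (auto simp: le_L_def)
qed

text \<open>The left factor \<open>x\<close> is a left divisor of \<open>d\<close>, the right factor
  \<open>y\<close> a right divisor; balance identifies the two kinds.\<close>

lemma Div_factors:
  assumes d: "balanced G M d" and "x \<in> M" "y \<in> M" "x \<otimes> y \<in> Div G M d"
  shows "x \<in> Div G M d" "y \<in> Div G M d"
proof -
  have "d \<in> M" using d by (simp add: balanced_def)
  obtain u v where "u \<in> M" "v \<in> M" "d = x \<otimes> y \<otimes> u" "d = v \<otimes> (x \<otimes> y)"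
    using Div_iff_left[OF \<open>d \<in> M\<close>] Div_iff_right[OF d] assms by metis
  then have "d = x \<otimes> (y \<otimes> u)" "d = (v \<otimes> x) \<otimes> y"
    using assms by (auto simp: m_assoc)
  then show "x \<in> Div G M d" "y \<in> Div G M d"
    using Div_iff_left[OF \<open>d \<in> M\<close>] Div_iff_right[OF d] assms \<open>u \<in> M\<close> \<open>v \<in> M\<close> m_closed by metis+
qed

lemma Delta_in_M [simp]: "\<Delta> \<in> M"
  using balanced_Delta by (simp add: balanced_def)

lemma Div_subset_carrier: "Div G M d \<subseteq> carrier G"
  by (auto simp: Div_def)

text \<open>The element \<open>d\<close> is itself a common multiple of \<open>a\<close> and
  \<open>b\<close>, so their lcm divides it, and so do the cofactors.\<close>

lemma Div_lcm:
  assumes d: "balanced G M d" and ab: "a \<in> Div G M d" "b \<in> Div G M d"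
  obtains x y where "x \<in> Div G M d" "y \<in> Div G M d" "x \<otimes> a \<in> Div G M d" "x \<otimes> a = y \<otimes> b"
    "\<And>u. u \<in> carrier G \<Longrightarrow> a \<preceq> u \<Longrightarrow> b \<preceq> u \<Longrightarrow> x \<otimes> a \<preceq> u"
proof -
  have M: "a \<in> M" "b \<in> M" "d \<in> M" using assms by (auto simp: Div_def balanced_def)
  then obtain x y where xy: "x \<in> M" "y \<in> M" "x \<otimes> a = y \<otimes> b"
    "\<And>u. u \<in> carrier G \<Longrightarrow> a \<preceq> u \<Longrightarrow> b \<preceq> u \<Longrightarrow> x \<otimes> a \<preceq> u"
    using rdvd_lcm by blast
  have "x \<otimes> a \<in> Div G M d"
    using ab M xy by (auto simp: Div_def)
  then show ?thesis
    using that xy Div_factors[OF d] M by metis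
qed

end

section \<open>Parabolic submonoids\<close>

locale parabolic = garside_structure +
  fixes K \<delta>
  assumes balanced_delta: "balanced G M \<delta>"
    and K_span: "K = monoid_span G (Div G M \<delta>)"
    and Div_delta: "Div G M \<delta> = Div G M \<Delta> \<inter> K"
begin

lemma delta_in_M [simp]: "\<delta> \<in> M"
  using balanced_delta by (simp add: balanced_def)

sublocale K: submonoid K G
  unfolding K_span by (rule monoid_span_submonoid) (rule Div_subset_carrier)

lemma K_subset: "K \<subseteq> M"
  unfolding K_span by (rule monoid_span_subset) (auto simp: Div_def submonoid_axioms)

lemma in_M [simp]: "x \<in> K \<Longrightarrow> x \<in> M"
  using K_subset by blast

lemma Div_in_K: "x \<in> Div G M \<delta> \<Longrightarrow> x \<in> K"
  using Div_delta by blast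

lemma delta_in_Div: "\<delta> \<in> Div G M \<delta>"
  by (simp add: Div_def)

lemma K_induct [consumes 1, case_names one mult]:
  assumes "a \<in> K" "P \<one>"
    and "\<And>a s. a \<in> K \<Longrightarrow> s \<in> Div G M \<delta> \<Longrightarrow> P a \<Longrightarrow> P (a \<otimes> s)"
  shows "P a"
  using monoid_span_induct_right[of a "Div G M \<delta>" P] Div_subset_carrier assms K_span by metis

section \<open>Closure of a parabolic submonoid under factors\<close>

lemma Div_Delta_right_factor:
  assumes "a \<in> K" "x \<in> M" "b \<in> Div G M \<Delta>" "a = x \<otimes> b"
  shows "b \<in> Div G M \<delta>"
  using assms
proof (induction a arbitrary: x b rule: K_induct)
  case one
  have "b \<in> M" using one by (simp add: Div_def)
  then have "b = \<one>" using mult_eq_one one by metis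
  then show ?case using one(2) Div_delta by (metis IntI K.one_closed)
next
  case (mult a s)
  have M: "s \<in> M" "b \<in> M" "a \<in> M" using mult.hyps mult.prems(2) by (auto simp: Div_def)
  have s: "s \<in> Div G M \<Delta>" using mult.hyps Div_delta by blast
  \<comment> \<open>The lcm of the last letter \<open>s\<close> and \<open>b\<close> still divides
    \<Delta>. As both divide \<open>a \<otimes> s\<close>, so does the lcm, and cancelling
    \<open>s\<close> leaves \<open>y\<close> as a right divisor of the shorter word
    \<open>a\<close>.\<close>
  obtain y z where yz: "y \<in> Div G M \<Delta>" "z \<in> Div G M \<Delta>" "y \<otimes> s \<in> Div G M \<Delta>" "y \<otimes> s = z \<otimes> b"
    "\<And>u. u \<in> carrier G \<Longrightarrow> s \<preceq> u \<Longrightarrow> b \<preceq> u \<Longrightarrow> y \<otimes> s \<preceq> u"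
    using Div_lcm[OF balanced_Delta s mult.prems(2)] by metis
  have yzM: "y \<in> M" "z \<in> M" using yz(1,2) by (auto simp: Div_def)
  have "b \<preceq> a \<otimes> s" using mult.prems M by (metis rdvd_mult mem_carrier)
  then have "y \<otimes> s \<preceq> a \<otimes> s" by (intro yz(5)) (use M in auto)
  then have "y \<preceq> a" using M yzM by simp
  then obtain w where "w \<in> M" "a = w \<otimes> y" using rdvdE M yzM by (metis mem_carrier)
  then have "y \<in> Div G M \<delta>" using mult.IH yz by metis
  \<comment> \<open>The lcm divides \<Delta> and lies in \<open>K\<close>, hence divides \<delta>;
    its factor \<open>b\<close> follows.\<close>
  then have "y \<otimes> s \<in> Div G M \<delta>"
    using yz(3) Div_delta mult.hyps(2) Div_in_K by blast
  then show ?case using yz(4) Div_factors[OF balanced_delta] yzM M by metis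
qed

text \<open>The same induction, with the lcm \<open>y \<otimes> s = z \<otimes> b\<close> now taken
  among the divisors of \<delta>: \<open>a = w \<otimes> y\<close> with \<open>w \<in> K\<close>
  yields \<open>x = w \<otimes> z\<close>.\<close>

lemma Div_left_quotient:
  assumes "a \<in> K" "x \<in> M" "b \<in> Div G M \<delta>" "a = x \<otimes> b"
  shows "x \<in> K"
  using assms
proof (induction a arbitrary: x b rule: K_induct)
  case one
  have "b \<in> M" using one by (simp add: Div_def)
  then have "x = \<one>" using mult_eq_one one by metis
  then show ?case by simp
next
  case (mult a s)
  have M: "s \<in> M" "b \<in> M" "a \<in> M" using mult by (auto simp: Div_def)
  obtain y z where yz: "y \<in> Div G M \<delta>" "z \<in> Div G M \<delta>" "y \<otimes> s = z \<otimes> b"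
    "\<And>u. u \<in> carrier G \<Longrightarrow> s \<preceq> u \<Longrightarrow> b \<preceq> u \<Longrightarrow> y \<otimes> s \<preceq> u"
    using Div_lcm[OF balanced_delta mult.hyps(2) mult.prems(2)] by metis
  have yzM: "y \<in> M" "z \<in> M" using yz(1,2) by (auto simp: Div_def)
  have "b \<preceq> a \<otimes> s" using mult.prems M by (metis rdvd_mult mem_carrier)
  then have "y \<otimes> s \<preceq> a \<otimes> s" by (intro yz(4)) (use M in auto)
  then have "y \<preceq> a" using M yzM by simp
  then obtain w where w: "w \<in> M" "a = w \<otimes> y" using rdvdE M yzM by (metis mem_carrier)
  then have "w \<in> K" using mult.IH yz by metis
  have "x \<otimes> b = (w \<otimes> z) \<otimes> b"
    using mult.prems(3) w yz yzM M by (simp add: m_assoc)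
  then have "x = w \<otimes> z" using mult.prems w yzM M by simp
  then show ?case using \<open>w \<in> K\<close> yz Div_in_K by simp
qed

text \<open>With \<open>y\<close> written as a word in divisors of \<Delta>, its last letter divides
  \<delta> by \<open>Div_Delta_right_factor\<close> and can be cancelled inside \<open>K\<close> by
  \<open>Div_left_quotient\<close>. Letters are removed one at a time.\<close>

lemma factor_closed:
  assumes "x \<in> M" "y \<in> M" "x \<otimes> y \<in> K"
  shows "x \<in> K" "y \<in> K"
proof -
  have "y \<in> monoid_span G (Div G M \<Delta>)" using assms Div_generates_monoid by simp
  then have "\<forall>x\<in>M. x \<otimes> y \<in> K \<longrightarrow> x \<in> K \<and> y \<in> K"
    using Div_subset_carrier
  proof (induction y rule: monoid_span_induct_right)
    case (mult y s)
    have M: "y \<in> M" "s \<in> M" using mult Div_generates_monoid by (auto simp: Div_def)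
    show ?case
    proof (intro ballI impI)
      fix x assume x: "x \<in> M" "x \<otimes> (y \<otimes> s) \<in> K"
      have eq: "x \<otimes> (y \<otimes> s) = (x \<otimes> y) \<otimes> s" using x M by (simp add: m_assoc)
      have s: "s \<in> Div G M \<delta>"
        by (rule Div_Delta_right_factor[OF x(2) _ _ eq]) (use mult.hyps x M in auto)
      then have "x \<otimes> y \<in> K"
        by (intro Div_left_quotient[OF x(2) _ _ eq]) (use x M in auto)
      then show "x \<in> K \<and> y \<otimes> s \<in> K" using mult.IH x(1) s Div_in_K by blast
    qed
  qed auto
  then show "x \<in> K" "y \<in> K" using assms by blast+
qed

section \<open>Common multiples inside a parabolic submonoid\<close>

lemma common_multiple_Div:
  assumes "a \<in> K" "s \<in> Div G M \<delta>"
  shows "\<exists>x \<in> Div G M \<delta>. \<exists>y \<in> K. x \<otimes> a = y \<otimes> s"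
  using assms
proof (induction a arbitrary: s rule: K_induct)
  case one
  then show ?case using Div_in_K by (intro bexI[of _ s] bexI[of _ \<one>]) auto
next
  case (mult a t)
  obtain x y where xy: "x \<in> Div G M \<delta>" "y \<in> Div G M \<delta>" "x \<otimes> t = y \<otimes> s"
    using Div_lcm[OF balanced_delta mult.hyps(2) mult.prems] by metis
  \<comment> \<open>The cofactor \<open>x\<close> is itself a divisor of \<delta>, so it can take
    the place of \<open>s\<close> against the shorter word. This is why the statement keeps one
    cofactor in \<open>Div G M \<delta>\<close> rather than merely in \<open>K\<close>.\<close>
  obtain u v where uv: "u \<in> Div G M \<delta>" "v \<in> K" "u \<otimes> a = v \<otimes> x"
    using mult.IH xy by metis
  have c: "x \<in> carrier G" "y \<in> carrier G" "u \<in> carrier G" "v \<in> carrier G" "a \<in> carrier G"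
    "s \<in> carrier G" "t \<in> carrier G"
    using xy uv mult Div_subset_carrier by auto
  have "u \<otimes> (a \<otimes> t) = (v \<otimes> x) \<otimes> t" using c uv by (simp add: m_assoc[symmetric])
  also have "\<dots> = (v \<otimes> y) \<otimes> s" using c xy by (simp add: m_assoc)
  finally show ?case using uv xy Div_in_K by blast
qed

lemma common_multiple:
  assumes "a \<in> K" "b \<in> K"
  shows "\<exists>x \<in> K. \<exists>y \<in> K. x \<otimes> a = y \<otimes> b"
  using assms(2,1)
proof (induction b arbitrary: a rule: K_induct)
  case one
  then show ?case by (intro bexI[of _ a] bexI[of _ \<one>]) auto
next
  case (mult b s)
  obtain x y where xy: "x \<in> Div G M \<delta>" "y \<in> K" "x \<otimes> a = y \<otimes> s"
    using common_multiple_Div mult by metis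
  obtain u v where uv: "u \<in> K" "v \<in> K" "u \<otimes> y = v \<otimes> b"
    using mult.IH xy by metis
  have c: "x \<in> carrier G" "y \<in> carrier G" "u \<in> carrier G" "v \<in> carrier G" "a \<in> carrier G"
    "s \<in> carrier G" "b \<in> carrier G"
    using xy uv mult Div_subset_carrier by auto
  have "(u \<otimes> x) \<otimes> a = (u \<otimes> y) \<otimes> s" using c xy by (simp add: m_assoc)
  also have "\<dots> = v \<otimes> (b \<otimes> s)" using c uv by (simp add: m_assoc)
  finally show ?case using uv xy Div_in_K by blast
qed

text \<open>The lcm formed in \<open>M\<close> divides a common multiple
  \<open>v \<otimes> a\<close> with \<open>v \<in> K\<close>; its cofactor is thus a factor of
  \<open>v\<close>, and \<open>factor_closed\<close> applies.\<close>

lemma lcm_in: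
  assumes "a \<in> K" "b \<in> K"
  obtains x where "x \<in> K" "b \<preceq> x \<otimes> a"
    "\<And>u. u \<in> carrier G \<Longrightarrow> a \<preceq> u \<Longrightarrow> b \<preceq> u \<Longrightarrow> x \<otimes> a \<preceq> u"
proof -
  obtain x y where xy: "x \<in> M" "y \<in> M" "x \<otimes> a = y \<otimes> b"
    "\<And>u. u \<in> carrier G \<Longrightarrow> a \<preceq> u \<Longrightarrow> b \<preceq> u \<Longrightarrow> x \<otimes> a \<preceq> u"
    using rdvd_lcm[of a b] assms by auto
  obtain v w where vw: "v \<in> K" "w \<in> K" "v \<otimes> a = w \<otimes> b" using common_multiple assms by metis
  have "x \<otimes> a \<preceq> v \<otimes> a" using xy(4)[of "v \<otimes> a"] vw assms by (metis K.m_closed K.mem_carrier in_M rdvd_mult)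
  then have "x \<preceq> v" using xy(1) vw(1) assms(1) by simp
  then obtain u where "u \<in> M" "v = u \<otimes> x" using rdvdE xy(1) vw(1) by (metis K.mem_carrier mem_carrier)
  then have "x \<in> K" using factor_closed(2) vw(1) xy(1) by metis
  moreover have "b \<preceq> x \<otimes> a" using xy(2,3) assms(2) by (metis K.mem_carrier rdvd_mult)
  ultimately show ?thesis using that[of x] xy(4) by metis
qed

section \<open>Tails\<close>

lemma tail_exists:
  assumes "a \<in> M"
  obtains b where "b \<in> K" "b \<preceq> a" "\<And>c. c \<in> K \<Longrightarrow> c \<preceq> a \<Longrightarrow> c \<preceq> b"
proof -
  define S where "S = {b \<in> K. b \<preceq> a}"
  have "\<one> \<in> S" using assms by (simp add: S_def le_R_def)
  moreover have "max_length b < Suc (max_length a)" if b: "b \<in> S" for b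
  proof -
    obtain x where "x \<in> M" "a = x \<otimes> b" using b assms by (auto simp: S_def elim: rdvdE)
    then show ?thesis using max_length_mult_ge[of x b] b by (auto simp: S_def)
  qed
  \<comment> \<open>Divisors of \<open>a\<close> are no longer than \<open>a\<close>, so a longest
    one in \<open>K\<close> exists. Its lcm with any other divisor in \<open>K\<close> is again such
    a divisor, hence not longer, hence equal to it.\<close>
  ultimately obtain b where b: "b \<in> S" "\<And>c. c \<in> S \<Longrightarrow> max_length c \<le> max_length b"
    using ex_has_greatest_nat[of "\<lambda>b. b \<in> S" \<one> max_length "Suc (max_length a)"] by auto
  then have bK: "b \<in> K" "b \<preceq> a" by (auto simp: S_def)
  have "c \<preceq> b" if c: "c \<in> K" "c \<preceq> a" for c
  proof -
    obtain x where x: "x \<in> K" "c \<preceq> x \<otimes> b"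
      "\<And>u. u \<in> carrier G \<Longrightarrow> b \<preceq> u \<Longrightarrow> c \<preceq> u \<Longrightarrow> x \<otimes> b \<preceq> u"
      using lcm_in[OF bK(1) c(1)] by metis
    then have "x \<otimes> b \<in> S" using bK c assms by (simp add: S_def)
    then have "max_length (x \<otimes> b) \<le> max_length b" by (rule b)
    then have "x = \<one>" using max_length_less_mult(2)[of b x] x bK by force
    then show ?thesis using x bK by simp
  qed
  then show ?thesis using that bK by blast
qed

lemma tail_eqI:
  assumes "a \<in> M" "b \<in> K" "b \<preceq> a" "\<And>c. c \<in> K \<Longrightarrow> c \<preceq> a \<Longrightarrow> c \<preceq> b"
  shows "tail G M K a = b"
  unfolding tail_def
proof (rule the_equality)
  show "b \<in> K \<and> {c \<in> K. c \<preceq> a} = {c \<in> K. c \<preceq> b}"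
    using assms by (auto intro: rdvd_trans)
next
  fix b' assume b': "b' \<in> K \<and> {c \<in> K. c \<preceq> a} = {c \<in> K. c \<preceq> b'}"
  then have "b' \<preceq> a" by (metis (mono_tags, lifting) K.mem_carrier mem_Collect_eq rdvd_refl)
  moreover have "b \<preceq> b'" using b' assms by blast
  ultimately show "b' = b" using assms b' by (intro rdvd_antisym) auto
qed

lemma
  assumes "a \<in> M"
  shows tail_closed [simp]: "tail G M K a \<in> K"
    and tail_rdvd: "tail G M K a \<preceq> a"
    and tail_greatest: "\<And>c. c \<in> K \<Longrightarrow> c \<preceq> a \<Longrightarrow> c \<preceq> tail G M K a"
  using assms by (metis tail_exists tail_eqI)+

text \<open>The lcm \<open>x \<otimes> c\<close> of \<open>c\<close> and any \<open>d\<close> in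
  \<open>K\<close> dividing \<open>a \<otimes> c\<close> divides \<open>a \<otimes> c\<close> as
  well. Cancelling \<open>c\<close> leaves a divisor \<open>x\<close> of \<open>a\<close> in
  \<open>K\<close>, which divides the tail of \<open>a\<close>.\<close>

lemma tail_mult:
  assumes "a \<in> M" "c \<in> K"
  shows "tail G M K (a \<otimes> c) = tail G M K a \<otimes> c"
proof (rule tail_eqI)
  show "a \<otimes> c \<in> M" "tail G M K a \<otimes> c \<in> K" using assms by auto
  show "tail G M K a \<otimes> c \<preceq> a \<otimes> c" using assms by (simp add: tail_rdvd)
next
  fix d assume d: "d \<in> K" "d \<preceq> a \<otimes> c"
  obtain x where x: "x \<in> K" "d \<preceq> x \<otimes> c"
    "\<And>u. u \<in> carrier G \<Longrightarrow> c \<preceq> u \<Longrightarrow> d \<preceq> u \<Longrightarrow> x \<otimes> c \<preceq> u"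
    using lcm_in[OF assms(2) d(1)] by metis
  have "x \<otimes> c \<preceq> a \<otimes> c" by (rule x(3)) (use d assms in auto)
  then have "x \<preceq> tail G M K a" using x(1) assms by (simp add: tail_greatest)
  then show "d \<preceq> tail G M K a \<otimes> c"
    using rdvd_trans[of d "x \<otimes> c" "tail G M K a \<otimes> c"] x(1,2) d(1) assms by simp
qed

lemma tail_self: "a \<in> K \<Longrightarrow> tail G M K a = a"
  by (rule tail_eqI) auto

lemma tail_quotient:
  assumes "a \<in> M"
  shows "\<exists>x\<in>M. a = x \<otimes> tail G M K a"
  using rdvdE[OF tail_rdvd[OF assms]] assms by (metis K.mem_carrier mem_carrier tail_closed)

text \<open>Clears denominators: the inverse of a generator becomes an element of \<open>K\<close>
  after one multiplication by \<delta>, and centrality gathers the powers of \<delta> on the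
  right.\<close>

lemma shift_into_submonoid:
  assumes "\<And>g. g \<in> generate G (Div G M \<delta>) \<Longrightarrow> \<delta> \<otimes> g = g \<otimes> \<delta>"
    and "\<alpha> \<in> generate G (Div G M \<delta>)"
  shows "\<exists>m::nat. \<alpha> \<otimes> \<delta> [^] m \<in> K"
  using assms(2)
proof induction
  case one
  then show ?case by (intro exI[of _ 0]) simp
next
  case (incl h)
  then show ?case using Div_in_K Div_subset_carrier by (intro exI[of _ 0]) auto
next
  case (inv h)
  then obtain y where y: "h \<in> M" "y \<in> M" "\<delta> = h \<otimes> y"
    using Div_iff_right[OF balanced_delta] by blast
  then have "inv h \<otimes> \<delta> = y" by (simp add: m_assoc[symmetric])
  moreover have "\<delta> \<in> K" using Div_in_K delta_in_Div by blast
  then have "y \<in> K" using factor_closed(2)[of h y] y by simp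
  ultimately show ?case by (intro exI[of _ 1]) simp
next
  case (eng h1 h2)
  then obtain m n :: nat where mn: "h1 \<otimes> \<delta> [^] m \<in> K" "h2 \<otimes> \<delta> [^] n \<in> K" by blast
  have c: "h1 \<in> carrier G" "h2 \<in> carrier G"
    using eng.hyps generate_in_carrier[OF Div_subset_carrier] by blast+
  have "\<delta> [^] m \<otimes> h2 = h2 \<otimes> \<delta> [^] m"
    by (rule group_commutes_pow) (use assms(1) eng.hyps c in auto)
  then have "(h1 \<otimes> \<delta> [^] m) \<otimes> (h2 \<otimes> \<delta> [^] n) = h1 \<otimes> h2 \<otimes> (\<delta> [^] m \<otimes> \<delta> [^] n)"
    using c by (metis delta_in_M m_assoc m_closed mem_carrier nat_pow_closed monoid.m_closed is_monoid)
  then have "h1 \<otimes> h2 \<otimes> \<delta> [^] (m + n) \<in> K"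
    using K.m_closed[OF mn] by (simp add: nat_pow_mult)
  then show ?case by blast
qed

end

section \<open>Alternating forms and depth\<close>

context garside_structure
begin

section \<open>Recursion and uniqueness for alternating forms\<close>

lemma alternating_form_snoc:
  "is_alternating_form G M N K a (w @ [x]) \<longleftrightarrow>
     set w \<subseteq> M \<and> x \<in> M \<and> a = word_prod G w \<otimes> x \<and> x = tail G M K a \<and>
     (if w = [] then x \<noteq> \<one> else is_alternating_form G M K N (word_prod G w) w)"
proof -
  define n where "n = length w"
  define letter where "letter N K v i \<longleftrightarrow> v ! (length v - i) =
    tail G M (if odd i then K else N) (word_prod G (take (length v - i + 1) v))" for N K v and i :: nat
  have split: "(\<forall>i\<in>{1..Suc n}. P i) \<longleftrightarrow> P 1 \<and> (\<forall>j\<in>{1..n}. P (Suc j))" for P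
  proof -
    have "{1..Suc n} = insert 1 (Suc ` {1..n})"
      by (auto simp: image_iff)
    then show ?thesis by (simp only: ball_simps)
  qed
  \<comment> \<open>Positions count from the right, so deleting the last letter lowers each index by
    one: parities flip and the two submonoids trade places, while the prefixes stay the
    same.\<close>
  have "letter N K (w @ [x]) (Suc j) \<longleftrightarrow> letter K N w j" if "j \<in> {1..n}" for j
    using that by (auto simp: letter_def nth_append n_def Suc_diff_Suc)
  then have "(\<forall>i\<in>{1..length (w @ [x])}. letter N K (w @ [x]) i) \<longleftrightarrow>
      letter N K (w @ [x]) 1 \<and> (\<forall>i\<in>{1..length w}. letter K N w i)"
    using split[of "letter N K (w @ [x])"] by (simp add: n_def)
  moreover have "letter N K (w @ [x]) 1 \<longleftrightarrow> x = tail G M K (word_prod G (w @ [x]))"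
    by (simp add: letter_def)
  moreover have "word_prod G (w @ [x]) = word_prod G w \<otimes> x" if "set w \<subseteq> M" "x \<in> M"
    using that word_prod_append[of w "[x]"] subset by auto
  moreover have "hd (w @ [x]) = (if w = [] then x else hd w)"
    by simp
  ultimately show ?thesis
    unfolding is_alternating_form_def letter_def[symmetric] by auto
qed

lemma alternating_form_snocD:
  assumes "is_alternating_form G M N K a (w @ [x])"
  shows "set w \<subseteq> M" "x \<in> M" "a = word_prod G w \<otimes> x" "x = tail G M K a"
    "w \<noteq> [] \<Longrightarrow> is_alternating_form G M K N (word_prod G w) w"
  using assms unfolding alternating_form_snoc by (blast | metis)+

lemma alternating_form_not_one:
  assumes "is_alternating_form G M N K a w"
  shows "a \<noteq> \<one>"
proof
  assume "a = \<one>"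
  obtain x v where "w = x # v" using assms by (cases w) (auto simp: is_alternating_form_def)
  then have "x \<in> M" "word_prod G v \<in> M" "x \<otimes> word_prod G v = \<one>" "x \<noteq> \<one>"
    using assms \<open>a = \<one>\<close> by (auto simp: is_alternating_form_def word_prod_closed)
  then show False using mult_eq_one by metis
qed

text \<open>The last letter must be the tail of \<open>a\<close>; cancelling it leaves two forms of
  one element for the swapped submonoids. An empty remainder has product \<open>\<one>\<close>,
  which no form represents.\<close>

lemma alternating_form_unique:
  assumes "is_alternating_form G M N K a w" "is_alternating_form G M N K a w'"
  shows "w = w'"
  using assms
proof (induction w arbitrary: a w' N K rule: rev_induct)
  case Nil
  then show ?case by (simp add: is_alternating_form_def)
next
  case (snoc x w)
  have "w' \<noteq> []" using snoc.prems(2) by (simp add: is_alternating_form_def)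
  then obtain v y where w': "w' = v @ [y]" by (meson rev_exhaust)
  have "y = x" using snoc.prems unfolding w' by (metis alternating_form_snocD(4))
  note w' = w'[unfolded this]
  have "x \<in> M" and w: "set w \<subseteq> M" "set v \<subseteq> M"
    using alternating_form_snocD[OF snoc.prems(1)] alternating_form_snocD[OF snoc.prems(2)[unfolded w']]
    by blast+
  have "word_prod G w \<otimes> x = word_prod G v \<otimes> x"
    using snoc.prems unfolding w' by (metis alternating_form_snocD(3))
  then have eq': "word_prod G w = word_prod G v"
    using word_prod_closed w \<open>x \<in> M\<close> by (metis mem_carrier r_cancel)
  show ?case
  proof (cases "w = []")
    case True
    then have "word_prod G v = \<one>" using eq' by simp
    then have "v = []"
      using snoc.prems(2) alternating_form_not_one alternating_form_snocD(5) unfolding w' by metis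
    then show ?thesis using True w' by simp
  next
    case False
    then have form: "is_alternating_form G M K N (word_prod G w) w"
      using alternating_form_snocD(5)[OF snoc.prems(1)] by simp
    moreover have "v \<noteq> []"
      using alternating_form_not_one[OF form] eq' by auto
    ultimately have "w = v"
      using snoc.IH snoc.prems(2) eq' alternating_form_snocD(5) unfolding w' by metis
    then show ?thesis using w' by simp
  qed
qed

lemma breadth_eq:
  "is_alternating_form G M N K a w \<Longrightarrow> breadth G M N K a = length w"
  using alternating_form_not_one[of N K a w] alternating_form_unique[of N K a w]
  unfolding breadth_def by (metis the_equality)

end

locale parabolic_pair = garside_structure G M \<Delta> +
  first: parabolic G M \<Delta> N \<Lambda> + second: parabolic G M \<Delta> M\<^sub>1 \<Delta>\<^sub>1
  for G (structure) and M \<Delta> N \<Lambda> M\<^sub>1 \<Delta>\<^sub>1 +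
  assumes generating: "monoid_span G (N \<union> M\<^sub>1) = M"
begin

section \<open>Existence of alternating forms\<close>

lemma trivial_tails:
  assumes "a \<in> M" "tail G M N a = \<one>" "tail G M M\<^sub>1 a = \<one>"
  shows "a = \<one>"
proof -
  have "a \<in> monoid_span G (N \<union> M\<^sub>1)" using assms generating by simp
  moreover have "N \<union> M\<^sub>1 \<subseteq> carrier G" by auto
  \<comment> \<open>The last nontrivial letter of a word for \<open>a\<close> in the generators
    \<open>N \<union> M\<^sub>1\<close> is a nontrivial right divisor.\<close>
  ultimately have "a \<noteq> \<one> \<longrightarrow> (\<exists>s \<in> N \<union> M\<^sub>1. s \<noteq> \<one> \<and> s \<preceq> a)"
  proof (induction a rule: monoid_span_induct_right)
    case (mult a s)
    then have M: "a \<in> M" "s \<in> M" using generating by auto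
    then show ?case using mult.IH mult.hyps(2) by (cases "s = \<one>") auto
  qed simp
  moreover have "s = \<one>" if "s \<in> N" "s \<preceq> a" for s
    using first.tail_greatest[OF assms(1) that] assms(2) that(1) rdvd_one by simp
  moreover have "s = \<one>" if "s \<in> M\<^sub>1" "s \<preceq> a" for s
    using second.tail_greatest[OF assms(1) that] assms(3) that(1) rdvd_one by simp
  ultimately show ?thesis by blast
qed

text \<open>Both orders of the submonoids are treated together, since removing a tail turns one
  order into the other.\<close>

lemma alternating_form_exists:
  assumes "a \<in> M" "a \<noteq> \<one>"
  shows "(\<exists>w. is_alternating_form G M N M\<^sub>1 a w) \<and> (\<exists>w. is_alternating_form G M M\<^sub>1 N a w)"
  using assms
proof (induction "max_length a" arbitrary: a rule: less_induct)
  case less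
  have quotient: "\<exists>x\<in>M. a = x \<otimes> tail G M K a" "tail G M K a \<in> M" if "K \<in> {N, M\<^sub>1}" for K
  proof -
    show "\<exists>x\<in>M. a = x \<otimes> tail G M K a"
      using that first.tail_quotient[OF less.prems(1)] second.tail_quotient[OF less.prems(1)] by blast
    show "tail G M K a \<in> M"
      using that less.prems(1) by auto
  qed
  have form: "\<exists>w. is_alternating_form G M K L a w"
    if KL: "(K, L) \<in> {(N, M\<^sub>1), (M\<^sub>1, N)}" and ne: "tail G M L a \<noteq> \<one>" for K L
  proof -
    obtain x where x: "x \<in> M" "a = x \<otimes> tail G M L a" "tail G M L a \<in> M"
      using quotient[of L] KL by blast
    show ?thesis
    proof (cases "x = \<one>")
      case True
      then have "is_alternating_form G M K L a ([] @ [tail G M L a])"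
        using x ne unfolding alternating_form_snoc by auto
      then show ?thesis by blast
    next
      case False
      have "max_length x < max_length a" using max_length_less_mult(1)[OF x(1,3) ne] x(2) by simp
      then obtain w where w: "is_alternating_form G M L K x w"
        using less.hyps x(1) False KL by blast
      then have "set w \<subseteq> M" "word_prod G w = x" "w \<noteq> []"
        by (auto simp: is_alternating_form_def)
      then have "is_alternating_form G M K L a (w @ [tail G M L a])"
        using x w unfolding alternating_form_snoc by auto
      then show ?thesis by blast
    qed
  qed
  \<comment> \<open>Removing a trivial tail shortens nothing, so the induction hypothesis does not
    apply; instead \<open>\<one>\<close> is appended to the form of the same element for the other
    order.\<close>
  have form': "\<exists>w. is_alternating_form G M L K a w"
    if KL: "(K, L) \<in> {(N, M\<^sub>1), (M\<^sub>1, N)}" and ne: "tail G M K a = \<one>" "tail G M L a \<noteq> \<one>" for K L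
  proof -
    obtain w where w: "is_alternating_form G M K L a w" using form KL ne by blast
    then have "set w \<subseteq> M" "word_prod G w = a" "w \<noteq> []"
      by (auto simp: is_alternating_form_def)
    then have "is_alternating_form G M L K a (w @ [\<one>])"
      using ne w less.prems unfolding alternating_form_snoc by simp
    then show ?thesis by blast
  qed
  show ?case
    using form[of N M\<^sub>1] form[of M\<^sub>1 N] form'[of N M\<^sub>1] form'[of M\<^sub>1 N]
      trivial_tails[OF less.prems(1)] less.prems(2) by blast
qed

section \<open>Depth and multiplication by \<open>M\<^sub>1\<close>\<close>

abbreviation "dpt \<equiv> depth G M N M\<^sub>1"

lemma depth_parabolic:
  assumes "a \<in> M\<^sub>1"
  shows "dpt a = 0"
proof (cases "a = \<one>")
  case False
  have "is_alternating_form G M N M\<^sub>1 a ([] @ [a])"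
    unfolding alternating_form_snoc using assms False by (simp add: second.tail_self)
  then have "breadth G M N M\<^sub>1 a = 1" using breadth_eq by fastforce
  then show ?thesis by (simp add: depth_def)
qed (simp add: depth_def breadth_def)

lemma depth_eq_0_imp:
  assumes "a \<in> M" "dpt a = 0"
  shows "a \<in> M\<^sub>1"
proof (cases "a = \<one>")
  case False
  then obtain w where w: "is_alternating_form G M N M\<^sub>1 a w"
    using alternating_form_exists assms by blast
  then obtain v x where "w = v @ [x]"
    by (cases w rule: rev_cases) (auto simp: is_alternating_form_def)
  \<comment> \<open>Nonempty words of even length, and words of odd length at least 3, have depth at
    least 1.\<close>
  moreover have "length w = 1"
    using assms(2) breadth_eq[OF w] \<open>w = v @ [x]\<close>
    by (auto simp: depth_def split: if_splits elim!: oddE evenE)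
  ultimately have "a = tail G M M\<^sub>1 a"
    using w alternating_form_snocD(2-4)[of N M\<^sub>1 a v x] by simp
  then show ?thesis using assms(1) second.tail_closed by metis
qed simp

text \<open>By \<open>tail_mult\<close> the factor \<open>c\<close> is absorbed into the last
  letter, which leaves the breadth unchanged. The case \<open>a \<in> M\<^sub>1\<close> is separate
  because it contains \<open>\<one>\<close>, which has no form.\<close>

lemma depth_mult_parabolic:
  assumes "a \<in> M" "c \<in> M\<^sub>1"
  shows "dpt (a \<otimes> c) = dpt a"
proof (cases "a \<in> M\<^sub>1")
  case True
  then show ?thesis using assms(2) depth_parabolic by simp
next
  case False
  then have "a \<noteq> \<one>" by auto
  then obtain w where w: "is_alternating_form G M N M\<^sub>1 a w"
    using alternating_form_exists assms by blast
  then obtain v x where wv: "w = v @ [x]"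
    by (cases w rule: rev_cases) (auto simp: is_alternating_form_def)
  note v = alternating_form_snocD[OF w[unfolded wv]]
  have "x \<in> M\<^sub>1" using v(4) assms(1) by (metis second.tail_closed)
  then have "v \<noteq> []" using False v(2,3) by auto
  moreover have "a \<otimes> c = word_prod G v \<otimes> (x \<otimes> c)"
    using v(1-3) assms word_prod_closed[of v] by (simp add: m_assoc)
  moreover have "x \<otimes> c = tail G M M\<^sub>1 (a \<otimes> c)"
    using v(4) assms by (metis second.tail_mult)
  moreover have "x \<otimes> c \<in> M" using v(2) assms(2) by simp
  ultimately have "is_alternating_form G M N M\<^sub>1 (a \<otimes> c) (v @ [x \<otimes> c])"
    unfolding alternating_form_snoc using v(1,5) by simp
  then have "breadth G M N M\<^sub>1 (a \<otimes> c) = breadth G M N M\<^sub>1 a"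
    using breadth_eq[OF w] breadth_eq wv by fastforce
  then show ?thesis by (simp add: depth_def)
qed

end

section \<open>Negative elements\<close>

lemma (in group) int_pow_commutes:
  fixes k :: int
  assumes "x \<in> carrier G" "y \<in> carrier G" "x \<otimes> y = y \<otimes> x"
  shows "x [^] k \<otimes> y = y \<otimes> x [^] k"
proof -
  have nat: "x [^] n \<otimes> y = y \<otimes> x [^] n" for n :: nat
    using assms group_commutes_pow by blast
  have inv: "inv z \<otimes> y = y \<otimes> inv z" if "z \<in> carrier G" "z \<otimes> y = y \<otimes> z" for z
  proof -
    have "inv z \<otimes> y = inv z \<otimes> (y \<otimes> z) \<otimes> inv z"
      using that(1) assms(2) by (simp add: m_assoc)
    also have "\<dots> = (inv z \<otimes> z) \<otimes> y \<otimes> inv z"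
      unfolding that(2)[symmetric] using that(1) assms(2) by (simp add: m_assoc[symmetric])
    finally show ?thesis using that(1) assms(2) by simp
  qed
  obtain n where "k = int n \<or> k = - int n" by (metis int_cases2)
  then show ?thesis
    using nat[of n] inv[of "x [^] n"] assms(1) by (auto simp: int_pow_int int_pow_neg_int)
qed

locale central_parabolic_pair = parabolic_pair +
  fixes G\<^sub>1 :: "'a set" and \<zeta> :: int
  assumes G1_generate: "G\<^sub>1 = generate G (Div G M \<Delta>\<^sub>1)"
    and M1_proper: "M\<^sub>1 \<noteq> M"
    and Delta_central: "g \<in> carrier G \<Longrightarrow> g \<otimes> \<Delta> = \<Delta> \<otimes> g"
    and Delta1_central: "g \<in> G\<^sub>1 \<Longrightarrow> g \<otimes> \<Delta>\<^sub>1 = \<Delta>\<^sub>1 \<otimes> g"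
    and zeta_pos: "\<zeta> \<ge> 1"
    and cond_A: "condition_A G M \<Delta> N M\<^sub>1 \<zeta>"
    and cond_B: "condition_B G M \<Delta> N M\<^sub>1 \<Delta>\<^sub>1 \<zeta>"
begin

sublocale G1: subgroup G\<^sub>1 G
  unfolding G1_generate by (rule generate_is_subgroup) (auto simp: Div_def)

lemma G1_carrier: "g \<in> G\<^sub>1 \<Longrightarrow> g \<in> carrier G"
  by (rule G1.mem_carrier)

lemma M1_in_G1: "a \<in> M\<^sub>1 \<Longrightarrow> a \<in> G\<^sub>1"
  by (induction a rule: second.K_induct) (auto simp: G1_generate intro: generate.intros)

text \<open>Factor closure would pull every divisor of \<Delta>, and with them all of
  \<open>M\<close>, into \<open>M\<^sub>1\<close>.\<close>

lemma Delta_notin_M1: "\<Delta> \<notin> M\<^sub>1"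
proof
  assume "\<Delta> \<in> M\<^sub>1"
  have "Div G M \<Delta> \<subseteq> M\<^sub>1"
  proof
    fix x assume "x \<in> Div G M \<Delta>"
    then obtain y where "x \<in> M" "y \<in> M" "\<Delta> = y \<otimes> x" using Div_iff_left by auto
    then show "x \<in> M\<^sub>1" using second.factor_closed(2)[of y x] \<open>\<Delta> \<in> M\<^sub>1\<close> by simp
  qed
  then have "M \<subseteq> M\<^sub>1"
    using monoid_span_subset[OF second.K.is_submonoid] Div_generates_monoid by metis
  then show False using second.K_subset M1_proper by blast
qed

lemma Delta_not_one: "\<Delta> \<noteq> \<one>"
  using Delta_notin_M1 by auto

section \<open>Existence and uniqueness of \<Delta>-forms\<close>

lemma Delta_pow_commutes: "g \<in> carrier G \<Longrightarrow> \<Delta> [^] (k::int) \<otimes> g = g \<otimes> \<Delta> [^] k"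
  by (rule int_pow_commutes) (auto simp: Delta_central)

lemma Delta_pow_mult: "\<Delta> [^] (i::int) \<otimes> \<Delta> [^] j = \<Delta> [^] (i + j)"
  by (simp add: int_pow_mult)

lemma mult_Delta_pow_assoc:
  "g \<in> carrier G \<Longrightarrow> g \<otimes> \<Delta> [^] (i::int) \<otimes> \<Delta> [^] j = g \<otimes> \<Delta> [^] (i + j)"
  by (simp add: m_assoc Delta_pow_mult)

lemma mult_Delta_pows:
  assumes "g \<in> carrier G" "h \<in> carrier G"
  shows "(g \<otimes> \<Delta> [^] (i::int)) \<otimes> (h \<otimes> \<Delta> [^] j) = (g \<otimes> h) \<otimes> \<Delta> [^] (i + j)"
proof -
  have "(g \<otimes> \<Delta> [^] i) \<otimes> (h \<otimes> \<Delta> [^] j) = g \<otimes> (\<Delta> [^] i \<otimes> h) \<otimes> \<Delta> [^] j"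
    using assms by (simp add: m_assoc)
  also have "\<dots> = (g \<otimes> h) \<otimes> (\<Delta> [^] i \<otimes> \<Delta> [^] j)"
    using assms unfolding Delta_pow_commutes[OF assms(2)] by (simp add: m_assoc)
  finally show ?thesis by (simp add: Delta_pow_mult)
qed

lemma Delta_pow_in_M: "0 \<le> k \<Longrightarrow> \<Delta> [^] (k::int) \<in> M"
proof -
  have "\<Delta> [^] n \<in> M" for n :: nat by (induction n) auto
  then show "0 \<le> k \<Longrightarrow> \<Delta> [^] (k::int) \<in> M" by (metis int_pow_int nonneg_int_cases)
qed

abbreviation "Delta_form \<equiv> is_Delta_form G M \<Delta>"

lemma Delta_formD:
  assumes "Delta_form \<alpha> a k"
  shows "a \<in> M" "\<not> \<Delta> \<preceq> a" "\<alpha> = a \<otimes> \<Delta> [^] k" "\<alpha> \<in> carrier G"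
  using assms by (auto simp: is_Delta_form_def unmovable_def)

lemma Delta_form_shift:
  "Delta_form \<alpha> a k \<Longrightarrow> Delta_form (\<alpha> \<otimes> \<Delta> [^] (j::int)) a (k + j)"
  by (auto simp: is_Delta_form_def unmovable_def mult_Delta_pow_assoc)

lemma Delta_form_le:
  assumes "Delta_form \<alpha> a k" "Delta_form \<alpha> b l"
  shows "l \<le> k"
proof (rule ccontr)
  assume "\<not> l \<le> k"
  note a = Delta_formD[OF assms(1)] and b = Delta_formD[OF assms(2)]
  have "a = \<alpha> \<otimes> \<Delta> [^] (- k)" using a(1,3) by (simp add: mult_Delta_pow_assoc)
  also have "\<dots> = b \<otimes> \<Delta> [^] (l + - k)" using b(1,3) by (simp add: mult_Delta_pow_assoc)
  \<comment> \<open>One \<Delta> is split off; \<open>l - k - 1\<close> is nonnegative since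
    \<open>l > k\<close>, so \<Delta> would divide the unmovable \<open>a\<close>.\<close>
  also have "\<dots> = b \<otimes> \<Delta> [^] (l - k - 1) \<otimes> \<Delta> [^] (1::int)"
    using b(1) by (subst mult_Delta_pow_assoc) auto
  finally have "a = (b \<otimes> \<Delta> [^] (l - k - 1)) \<otimes> \<Delta>" by simp
  moreover have "b \<otimes> \<Delta> [^] (l - k - 1) \<in> M"
    using b(1) Delta_pow_in_M \<open>\<not> l \<le> k\<close> by simp
  ultimately have "\<Delta> \<preceq> a" by simp
  then show False using a(2) by contradiction
qed

lemma Delta_form_unique:
  assumes "Delta_form \<alpha> a k" "Delta_form \<alpha> b l"
  shows "a = b" "k = l"
proof -
  show "k = l" using Delta_form_le assms by (meson order_antisym)
  then have "a \<otimes> \<Delta> [^] k = b \<otimes> \<Delta> [^] k" using Delta_formD(3) assms by metis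
  then show "a = b" using Delta_formD(1) assms by simp
qed

lemma Delta_form_one: "Delta_form \<one> \<one> 0"
  using rdvd_one[of \<Delta>] Delta_not_one by (auto simp: is_Delta_form_def unmovable_def)

lemma Delta_form_exists_M:
  assumes "a \<in> M"
  shows "\<exists>b k. Delta_form a b k"
  using assms
proof (induction "max_length a" arbitrary: a rule: less_induct)
  case less
  show ?case
  proof (cases "\<Delta> \<preceq> a")
    case True
    then obtain x where x: "x \<in> M" "a = x \<otimes> \<Delta>" using less.prems by (auto elim: rdvdE)
    then obtain b k where "Delta_form x b k"
      using less.hyps max_length_less_mult(1) Delta_not_one Delta_in_M by metis
    then have "Delta_form (x \<otimes> \<Delta> [^] (1::int)) b (k + 1)" by (rule Delta_form_shift)
    then show ?thesis using x(2) by auto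
  next
    case False
    then have "Delta_form a a 0" using less.prems by (simp add: is_Delta_form_def unmovable_def)
    then show ?thesis by blast
  qed
qed

lemma Delta_form_exists:
  assumes "\<alpha> \<in> carrier G"
  shows "\<exists>a k. Delta_form \<alpha> a k"
proof -
  \<comment> \<open>Regarding \<open>M\<close> as parabolic in itself with \<delta> = \<Delta> lets
    \<open>shift_into_submonoid\<close> move \<alpha> into \<open>M\<close>; the power of \<Delta>
    is removed again afterwards.\<close>
  interpret whole: parabolic G M \<Delta> M \<Delta>
    by standard (simp add: balanced_Delta, simp add: Div_generates_monoid, auto simp: Div_def)
  have "\<exists>m::nat. \<alpha> \<otimes> \<Delta> [^] m \<in> M"
    by (rule whole.shift_into_submonoid) (use assms in \<open>simp_all add: Div_generates_group Delta_central\<close>)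
  then obtain m :: nat and a k where "Delta_form (\<alpha> \<otimes> \<Delta> [^] int m) a k"
    using Delta_form_exists_M by (metis int_pow_int)
  then have "Delta_form (\<alpha> \<otimes> \<Delta> [^] int m \<otimes> \<Delta> [^] (- int m)) a (k + - int m)"
    by (rule Delta_form_shift)
  then show ?thesis using assms by (auto simp: mult_Delta_pow_assoc)
qed

section \<open>The element \<theta> and \<Delta>-forms on \<open>G\<^sub>1\<close>\<close>

definition \<theta> :: 'a where "\<theta> = \<Delta> \<otimes> inv \<Delta>\<^sub>1"

lemma Delta1_in_M1: "\<Delta>\<^sub>1 \<in> M\<^sub>1"
  using second.Div_in_K second.delta_in_Div by blast

lemma Delta1_in_G1: "\<Delta>\<^sub>1 \<in> G\<^sub>1"
  using Delta1_in_M1 M1_in_G1 by blast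

lemma theta_mult_Delta1: "\<theta> \<otimes> \<Delta>\<^sub>1 = \<Delta>"
  by (simp add: \<theta>_def m_assoc)

lemma theta_in_M [simp]: "\<theta> \<in> M"
proof -
  have "\<Delta>\<^sub>1 \<in> Div G M \<Delta>" using second.delta_in_Div second.Div_delta by blast
  then show ?thesis by (simp add: \<theta>_def Div_def le_R_def)
qed

lemma theta_commutes:
  assumes "g \<in> G\<^sub>1"
  shows "\<theta> \<otimes> g = g \<otimes> \<theta>"
proof -
  have g: "g \<in> carrier G" using assms by (rule G1_carrier)
  have "inv \<Delta>\<^sub>1 \<otimes> g = g \<otimes> inv \<Delta>\<^sub>1"
    using int_pow_commutes[of \<Delta>\<^sub>1 g "- 1"] Delta1_central[OF assms] g by (simp add: int_pow_neg)
  then have "\<theta> \<otimes> g = \<Delta> \<otimes> g \<otimes> inv \<Delta>\<^sub>1" using g by (simp add: \<theta>_def m_assoc)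
  also have "\<dots> = g \<otimes> \<theta>" using g by (simp add: \<theta>_def m_assoc flip: Delta_central)
  finally show ?thesis .
qed

lemma theta_pow_commutes: "g \<in> G\<^sub>1 \<Longrightarrow> \<theta> [^] (k::int) \<otimes> g = g \<otimes> \<theta> [^] k"
  by (rule int_pow_commutes) (auto simp: theta_commutes G1_carrier)

lemma theta_pow_in_M [simp]: "\<theta> [^] (n::nat) \<in> M"
  by (induction n) auto

lemma Delta_pow_eq: "\<Delta> [^] (k::int) = \<theta> [^] k \<otimes> \<Delta>\<^sub>1 [^] k"
  using int_pow_mult_distrib[of \<theta> \<Delta>\<^sub>1 k] theta_commutes[OF Delta1_in_G1]
  by (simp add: theta_mult_Delta1)

text \<open>For \<open>n = 1\<close>: \<open>x \<Delta>\<^sub>1\<close> lies in \<open>M\<^sub>1\<close> and divides \<open>\<Delta>\<close>, hence divides \<open>\<Delta>\<^sub>1\<close>. For the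
  induction step, \<open>\<theta> x = x \<theta>\<close> is a common multiple of \<open>x\<close> and \<open>\<theta>\<close>, so the cofactor of \<open>\<theta>\<close>
  in their lcm divides \<open>x\<close> and lies in \<open>M\<^sub>1\<close>.\<close>

lemma rdvd_theta_pow_imp_one:
  assumes "x \<in> M\<^sub>1" "x \<preceq> \<theta> [^] (n::nat)"
  shows "x = \<one>"
  using assms
proof (induction n arbitrary: x)
  case 0
  then show ?case using rdvd_one by simp
next
  case (Suc n)
  obtain u y where uy: "u \<in> M" "y \<in> M" "u \<otimes> x = y \<otimes> \<theta>"
    "\<And>v. v \<in> carrier G \<Longrightarrow> x \<preceq> v \<Longrightarrow> \<theta> \<preceq> v \<Longrightarrow> u \<otimes> x \<preceq> v"
    using rdvd_lcm[of x \<theta>] Suc.prems by auto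
  have comm: "\<theta> \<otimes> x = x \<otimes> \<theta>" using theta_commutes M1_in_G1 Suc.prems by blast
  have "u \<otimes> x \<preceq> x \<otimes> \<theta>"
    using Suc.prems comm rdvd_mult[of \<theta> x] by (intro uy(4)) auto
  then have "y \<otimes> \<theta> \<preceq> x \<otimes> \<theta>" unfolding uy(3) .
  then have "y \<preceq> x" using uy(2) Suc.prems(1) by simp
  then obtain w where "w \<in> M" "x = w \<otimes> y" using rdvdE uy(2) Suc.prems(1) by (metis mem_carrier second.in_M)
  then have "y \<in> M\<^sub>1" using second.factor_closed(2) uy(2) Suc.prems(1) by metis
  have "u \<otimes> x \<preceq> \<theta> [^] n \<otimes> \<theta>" using Suc.prems by (intro uy(4)) auto
  then have "y \<otimes> \<theta> \<preceq> \<theta> [^] n \<otimes> \<theta>" unfolding uy(3) .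
  then have "y \<preceq> \<theta> [^] n" using uy(2) by simp
  then have "y = \<one>" using Suc.IH \<open>y \<in> M\<^sub>1\<close> by blast
  then have "\<Delta> = (u \<otimes> x) \<otimes> \<Delta>\<^sub>1" using uy(3) theta_mult_Delta1 theta_in_M by (metis l_one mem_carrier)
  then have "\<Delta> = u \<otimes> (x \<otimes> \<Delta>\<^sub>1)" using uy(1) Suc.prems(1) by (simp add: m_assoc)
  then have "x \<otimes> \<Delta>\<^sub>1 \<in> Div G M \<Delta>"
    using Div_iff_left[of \<Delta>] uy(1) Suc.prems(1) by auto
  then have "x \<otimes> \<Delta>\<^sub>1 \<in> Div G M \<Delta>\<^sub>1"
    using second.Div_delta Delta1_in_M1 Suc.prems(1) by blast
  then have "x \<otimes> \<Delta>\<^sub>1 \<preceq> \<one> \<otimes> \<Delta>\<^sub>1" by (simp add: Div_def)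
  then have "x \<preceq> \<one>" using Suc.prems(1) rdvd_mult_cancel[of x \<one> \<Delta>\<^sub>1] by simp
  then show ?case using rdvd_one Suc.prems(1) by simp
qed

text \<open>For \<open>m = 0\<close> factor closure would put \<Delta> in \<open>M\<^sub>1\<close>.
  Otherwise cancelling \<theta> from \<open>\<Delta> = \<Delta>\<^sub>1 \<otimes> \<theta>\<close>
  leaves \<open>\<Delta>\<^sub>1\<close> dividing \<open>\<theta> [^] n \<otimes> c\<close>. The lcm
  of \<open>c\<close> and \<open>\<Delta>\<^sub>1\<close> has a cofactor in \<open>M\<^sub>1\<close>
  dividing a power of \<theta>, hence trivial, so \<open>\<Delta>\<^sub>1\<close> would divide
  \<open>c\<close>.\<close>

lemma unmovable_theta_pow:
  assumes c: "c \<in> M\<^sub>1" and not: "m \<noteq> 0 \<Longrightarrow> \<not> \<Delta>\<^sub>1 \<preceq> c"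
  shows "\<not> \<Delta> \<preceq> \<theta> [^] (m::nat) \<otimes> c"
proof
  assume dvd: "\<Delta> \<preceq> \<theta> [^] m \<otimes> c"
  show False
  proof (cases m)
    case 0
    then obtain x where "x \<in> M" "c = x \<otimes> \<Delta>" using dvd c by (auto elim: rdvdE)
    then show False using second.factor_closed(2)[of x \<Delta>] c Delta_notin_M1 by simp
  next
    case (Suc n)
    have "\<theta> \<otimes> c = c \<otimes> \<theta>" using theta_commutes M1_in_G1 c by blast
    then have "\<theta> [^] m \<otimes> c = (\<theta> [^] n \<otimes> c) \<otimes> \<theta>" using Suc c by (simp add: m_assoc)
    moreover have "\<Delta> = \<Delta>\<^sub>1 \<otimes> \<theta>" using theta_mult_Delta1 theta_commutes Delta1_in_G1 by simp
    ultimately have "\<Delta>\<^sub>1 \<otimes> \<theta> \<preceq> (\<theta> [^] n \<otimes> c) \<otimes> \<theta>" using dvd by metis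
    then have dvd': "\<Delta>\<^sub>1 \<preceq> \<theta> [^] n \<otimes> c" using c by simp
    obtain x where x: "x \<in> M\<^sub>1" "\<Delta>\<^sub>1 \<preceq> x \<otimes> c"
      "\<And>u. u \<in> carrier G \<Longrightarrow> c \<preceq> u \<Longrightarrow> \<Delta>\<^sub>1 \<preceq> u \<Longrightarrow> x \<otimes> c \<preceq> u"
      using second.lcm_in[OF c Delta1_in_M1] by metis
    have "x \<otimes> c \<preceq> \<theta> [^] n \<otimes> c" by (rule x(3)) (use c dvd' in auto)
    then have "x = \<one>" using x(1) c rdvd_theta_pow_imp_one[of x n] by simp
    then show False using x(2) c not Suc by simp
  qed
qed

text \<open>Here \<open>m\<close> is the least power of \<open>\<Delta>\<^sub>1\<close> that moves
  \<gamma> into \<open>M\<^sub>1\<close>; rewriting \<open>\<Delta>\<^sub>1\<close> through \<Delta>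
  and \<theta> produces the factor \<open>\<theta> [^] m\<close>.\<close>

lemma Delta_form_G1:
  assumes "\<gamma> \<in> G\<^sub>1"
  obtains m :: nat and c where "c \<in> M\<^sub>1" "Delta_form \<gamma> (\<theta> [^] m \<otimes> c) (- int m)"
proof -
  define m where "m = (LEAST m::nat. \<gamma> \<otimes> \<Delta>\<^sub>1 [^] m \<in> M\<^sub>1)"
  define c where "c = \<gamma> \<otimes> \<Delta>\<^sub>1 [^] m"
  have g: "\<gamma> \<in> carrier G" using assms by (rule G1_carrier)
  have "\<exists>m::nat. \<gamma> \<otimes> \<Delta>\<^sub>1 [^] m \<in> M\<^sub>1"
    using second.shift_into_submonoid[of \<gamma>] assms Delta1_central by (simp add: G1_generate)
  then have c: "c \<in> M\<^sub>1" unfolding c_def m_def by (rule LeastI_ex)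
  \<comment> \<open>If \<open>\<Delta>\<^sub>1\<close> divided \<open>c\<close>, the exponent
    \<open>m - 1\<close> would already suffice.\<close>
  have "\<not> \<Delta>\<^sub>1 \<preceq> c" if m: "m \<noteq> 0"
  proof
    assume "\<Delta>\<^sub>1 \<preceq> c"
    then obtain y where y: "y \<in> M" "c = y \<otimes> \<Delta>\<^sub>1" using c by (auto elim: rdvdE)
    obtain n where n: "m = Suc n" using m not0_implies_Suc by blast
    have "y \<otimes> \<Delta>\<^sub>1 = (\<gamma> \<otimes> \<Delta>\<^sub>1 [^] n) \<otimes> \<Delta>\<^sub>1"
      using y(2) g by (simp add: c_def n m_assoc)
    then have "y = \<gamma> \<otimes> \<Delta>\<^sub>1 [^] n" using y(1) g by simp
    moreover have "y \<in> M\<^sub>1" using y c second.factor_closed(1)[of y \<Delta>\<^sub>1] by simp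
    ultimately have "m \<le> n" unfolding m_def by (intro Least_le) simp
    then show False using n by simp
  qed
  then have "\<not> \<Delta> \<preceq> \<theta> [^] m \<otimes> c" using unmovable_theta_pow c by blast
  moreover have "(\<theta> [^] m \<otimes> c) \<otimes> \<Delta> [^] (- int m) = \<gamma>"
  proof -
    have "\<theta> [^] int m \<otimes> c = c \<otimes> \<theta> [^] int m"
      using theta_pow_commutes M1_in_G1 c by blast
    also have "\<dots> = \<gamma> \<otimes> (\<Delta>\<^sub>1 [^] int m \<otimes> \<theta> [^] int m)"
      using g by (simp add: c_def m_assoc int_pow_int)
    also have "\<dots> = \<gamma> \<otimes> \<Delta> [^] int m"
    proof -
      have "\<Delta>\<^sub>1 [^] int m \<in> G\<^sub>1"
        using Delta1_in_G1 by (metis subgroup_int_pow_closed G1.subgroup_axioms)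
      then show ?thesis using theta_pow_commutes Delta_pow_eq by metis
    qed
    finally have "\<theta> [^] m \<otimes> c \<otimes> \<Delta> [^] (- int m) = \<gamma> \<otimes> \<Delta> [^] int m \<otimes> \<Delta> [^] (- int m)"
      by (simp only: int_pow_int)
    then show ?thesis using g by (simp add: mult_Delta_pow_assoc)
  qed
  ultimately have "Delta_form \<gamma> (\<theta> [^] m \<otimes> c) (- int m)"
    using c by (simp add: is_Delta_form_def unmovable_def)
  then show ?thesis using that c by blast
qed

text \<open>Depth ignores right factors from \<open>M\<^sub>1\<close>, so \<open>c\<close> may be
  replaced by \<open>\<Delta>\<^sub>1 [^] m\<close>, which turns the product into a power of
  \<Delta>. Condition A then applies for \<open>m \<ge> 1\<close>.\<close>

lemma depth_theta_pow:
  assumes "c \<in> M\<^sub>1" "m \<noteq> 0"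
  shows "int (dpt (\<theta> [^] (m::nat) \<otimes> c)) = \<zeta> * int m + 1"
proof -
  have "\<Delta>\<^sub>1 [^] m \<in> M\<^sub>1" using Delta1_in_M1 by (induction m) auto
  then have "dpt (\<theta> [^] m \<otimes> c) = dpt (\<theta> [^] m \<otimes> \<Delta>\<^sub>1 [^] m)"
    using assms depth_mult_parabolic by simp
  also have "\<dots> = dpt (\<Delta> [^] int m)" using Delta_pow_eq[of "int m"] by (simp add: int_pow_int)
  finally show ?thesis using cond_A assms(2) by (simp add: condition_A_def)
qed

section \<open>Negativity read off from \<Delta>-forms\<close>

abbreviation "neg \<equiv> negative G M \<Delta> N M\<^sub>1"

text \<open>The \<open>+ 1\<close> in Condition A turns the strict comparison of depths into a weak
  one; uniqueness of \<Delta>-forms removes the existential.\<close>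

lemma neg_iff:
  assumes "Delta_form \<alpha> a p"
  shows "neg \<alpha> \<longleftrightarrow> p \<le> - 1 \<and> int (dpt a) \<le> - \<zeta> * p"
proof -
  have *: "dpt a < dpt (\<Delta> [^] k) \<longleftrightarrow> int (dpt a) \<le> \<zeta> * k" if "k \<ge> 1" for k :: int
    using cond_A that unfolding condition_A_def by (auto simp flip: of_nat_less_iff[where 'a = int])
  show ?thesis
  proof
    assume "neg \<alpha>"
    then obtain b k where "Delta_form \<alpha> b (- k)" "k \<ge> 1" "dpt b < dpt (\<Delta> [^] k)"
      unfolding negative_def by blast
    moreover from this have "b = a" "- k = p" using Delta_form_unique assms by blast+
    ultimately show "p \<le> - 1 \<and> int (dpt a) \<le> - \<zeta> * p" using * by auto
  next
    assume "p \<le> - 1 \<and> int (dpt a) \<le> - \<zeta> * p"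
    then show "neg \<alpha>" unfolding negative_def
      using assms *[of "- p"] by (intro exI[of _ a] exI[of _ "- p"]) auto
  qed
qed

text \<open>The subgroup \<open>Z\<close> generated by \<open>G\<^sub>1\<close> and \<open>\<Delta>\<close> consists of the elements whose \<open>\<Delta>\<close>-form
  \<open>a \<Delta>\<^sup>k\<close> has \<open>a \<in> \<Theta> \<union> M\<^sub>1\<close>; Condition B says nothing about products inside it.\<close>

definition Z :: "'a set" where
  "Z = {\<gamma> \<otimes> \<Delta> [^] (j::int) | \<gamma> j. \<gamma> \<in> G\<^sub>1}"

lemma Z_I: "\<gamma> \<in> G\<^sub>1 \<Longrightarrow> \<gamma> \<otimes> \<Delta> [^] (j::int) \<in> Z"
  by (auto simp: Z_def)

lemma Z_E:
  assumes "\<alpha> \<in> Z"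
  obtains \<gamma> and j :: int where "\<gamma> \<in> G\<^sub>1" "\<alpha> = \<gamma> \<otimes> \<Delta> [^] j"
  using assms by (auto simp: Z_def)

lemma G1_subset_Z: "\<gamma> \<in> G\<^sub>1 \<Longrightarrow> \<gamma> \<in> Z"
  using Z_I[of \<gamma> 0] G1_carrier by simp

lemma Z_mult: "\<alpha> \<in> Z \<Longrightarrow> \<beta> \<in> Z \<Longrightarrow> \<alpha> \<otimes> \<beta> \<in> Z"
  by (elim Z_E) (auto simp: mult_Delta_pows G1_carrier intro!: Z_I)

lemma inv_mult_Delta_pow:
  assumes "\<gamma> \<in> carrier G"
  shows "inv (\<gamma> \<otimes> \<Delta> [^] (j::int)) = inv \<gamma> \<otimes> \<Delta> [^] (- j)"
  using assms Delta_pow_commutes[of "inv \<gamma>" "- j"] by (simp add: inv_mult_group int_pow_neg)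

lemma Z_inv: "\<alpha> \<in> Z \<Longrightarrow> inv \<alpha> \<in> Z"
  by (elim Z_E) (auto simp: inv_mult_Delta_pow G1_carrier intro!: Z_I)

text \<open>The coefficient \<open>\<theta> [^] m \<otimes> c\<close> has depth 0 for
  \<open>m = 0\<close> and \<open>\<zeta> * m + 1\<close> otherwise. In the second case the terms in
  \<open>m\<close> cancel and the inequality becomes \<open>1 \<le> - \<zeta> * j\<close>.\<close>

lemma neg_Z_iff:
  assumes "\<gamma> \<in> G\<^sub>1"
  shows "neg (\<gamma> \<otimes> \<Delta> [^] (j::int)) \<longleftrightarrow> j < 0"
proof -
  obtain m :: nat and c where c: "c \<in> M\<^sub>1" "Delta_form \<gamma> (\<theta> [^] m \<otimes> c) (- int m)"
    using Delta_form_G1[OF assms] by blast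
  then have "neg (\<gamma> \<otimes> \<Delta> [^] j) \<longleftrightarrow>
      - int m + j \<le> - 1 \<and> int (dpt (\<theta> [^] m \<otimes> c)) \<le> - \<zeta> * (- int m + j)"
    using neg_iff[OF Delta_form_shift] by blast
  also have "\<dots> \<longleftrightarrow> j < 0"
  proof (cases "m = 0")
    case True
    have "0 \<le> - \<zeta> * j" if "j < 0"
      using that zeta_pos by (simp add: mult_nonneg_nonpos)
    then show ?thesis using True c(1) depth_parabolic by auto
  next
    case False
    have "1 \<le> - \<zeta> * j \<longleftrightarrow> j < 0"
      using zeta_pos mult_less_0_iff[of \<zeta> j] by auto
    then show ?thesis unfolding depth_theta_pow[OF c(1) False] by (auto simp: algebra_simps)
  qed
  finally show ?thesis .
qed

text \<open>Each power of \<theta> is a power of \<Delta> times a power of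
  \<open>\<Delta>\<^sub>1\<close>, hence in \<open>Z\<close>. Contrapositively, a pair not wholly in
  \<open>Z\<close> has coefficients to which Condition B applies.\<close>

lemma Theta_bar_imp_Z:
  assumes "Delta_form \<alpha> a p" "a \<in> Theta_bar G \<Delta> M\<^sub>1 \<Delta>\<^sub>1"
  shows "\<alpha> \<in> Z"
proof -
  have \<alpha>: "\<alpha> = a \<otimes> \<Delta> [^] p" using Delta_formD assms by blast
  from assms(2) consider "a \<in> M\<^sub>1" | k c where "c \<in> M\<^sub>1" "a = \<theta> [^] (k::int) \<otimes> c"
    by (auto simp: Theta_bar_def Theta_def \<theta>_def)
  then have "a \<in> Z"
  proof cases
    case 1
    then show ?thesis using G1_subset_Z M1_in_G1 by blast
  next
    case (2 k c)
    have "\<Delta>\<^sub>1 [^] k \<in> G\<^sub>1"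
      using Delta1_in_G1 by (metis subgroup_int_pow_closed G1.subgroup_axioms)
    then have D: "\<Delta>\<^sub>1 [^] k \<in> Z" "\<theta> [^] k \<otimes> \<Delta>\<^sub>1 [^] k = \<one> \<otimes> \<Delta> [^] k"
      using G1_subset_Z Delta_pow_eq by auto
    then have "\<theta> [^] k = (\<one> \<otimes> \<Delta> [^] k) \<otimes> inv (\<Delta>\<^sub>1 [^] k)"
      using inv_solve_right[of "\<theta> [^] k" "\<one> \<otimes> \<Delta> [^] k" "\<Delta>\<^sub>1 [^] k"] by simp
    then have "\<theta> [^] k \<in> Z" using D Z_mult Z_inv Z_I[of \<one> k] by simp
    then show ?thesis using 2 Z_mult G1_subset_Z M1_in_G1 by blast
  qed
  then show ?thesis using \<alpha> Z_mult Z_I[of \<one> p] by simp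
qed

lemma Delta_form_mult:
  assumes "Delta_form \<alpha> a p" "Delta_form \<beta> b q" "Delta_form (a \<otimes> b) c t"
  shows "Delta_form (\<alpha> \<otimes> \<beta>) c (t + (p + q))"
proof -
  have "\<alpha> \<otimes> \<beta> = (a \<otimes> b) \<otimes> \<Delta> [^] (p + q)"
    using Delta_formD[OF assms(1)] Delta_formD[OF assms(2)] by (simp add: mult_Delta_pows)
  then show ?thesis using Delta_form_shift[OF assms(3)] by simp
qed

lemma condition_B_product:
  assumes "Delta_form \<alpha> a p" "Delta_form \<beta> b q" "\<not> (\<alpha> \<in> Z \<and> \<beta> \<in> Z)" "Delta_form (a \<otimes> b) c t"
  obtains \<epsilon> :: int where "\<epsilon> \<in> {0, 1}"
    "int (dpt c) = int (dpt a) + int (dpt b) - \<zeta> * t - \<epsilon>"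
    "a \<in> Theta G \<Delta> M\<^sub>1 \<Delta>\<^sub>1 \<or> b \<in> Theta G \<Delta> M\<^sub>1 \<Delta>\<^sub>1 \<or> c \<in> M\<^sub>1 \<Longrightarrow> \<epsilon> = 1"
proof -
  have "(a, b) \<in> M \<times> M - Theta_bar G \<Delta> M\<^sub>1 \<Delta>\<^sub>1 \<times> Theta_bar G \<Delta> M\<^sub>1 \<Delta>\<^sub>1"
    using assms(1-3) Theta_bar_imp_Z Delta_formD(1) by blast
  moreover have "unmovable G M \<Delta> a" "unmovable G M \<Delta> b"
    using assms(1,2) by (auto simp: is_Delta_form_def)
  ultimately show ?thesis
    using cond_B assms(4) that unfolding condition_B_def by blast
qed

text \<open>Write \<open>\<alpha> \<beta> = c \<Delta>\<^sup>s\<close>. Condition B gives \<open>0 \<le> dpt c \<le> - \<zeta> s\<close>, and the boundary case \<open>s = 0\<close>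
  forces \<open>dpt c = 0\<close>, i.e. \<open>c \<in> M\<^sub>1\<close>, where the correction term \<open>\<epsilon>\<close> is \<open>1\<close>.\<close>

lemma neg_mult_criterion:
  assumes \<alpha>: "Delta_form \<alpha> a p" and \<beta>: "Delta_form \<beta> b q" and Z: "\<not> (\<alpha> \<in> Z \<and> \<beta> \<in> Z)"
    and bound: "int (dpt a) + int (dpt b) \<le> - \<zeta> * (p + q) \<or>
      int (dpt a) + int (dpt b) \<le> - \<zeta> * (p + q) + 1 \<and>
      (a \<in> Theta G \<Delta> M\<^sub>1 \<Delta>\<^sub>1 \<or> b \<in> Theta G \<Delta> M\<^sub>1 \<Delta>\<^sub>1) \<and> \<alpha> \<otimes> \<beta> \<notin> G\<^sub>1"
  shows "neg (\<alpha> \<otimes> \<beta>)"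
proof -
  obtain c t where c: "Delta_form (a \<otimes> b) c t"
    using Delta_form_exists_M[of "a \<otimes> b"] Delta_formD(1) \<alpha> \<beta> by blast
  obtain \<epsilon> where \<epsilon>: "\<epsilon> \<in> {0, 1}" "int (dpt c) = int (dpt a) + int (dpt b) - \<zeta> * t - \<epsilon>"
    "a \<in> Theta G \<Delta> M\<^sub>1 \<Delta>\<^sub>1 \<or> b \<in> Theta G \<Delta> M\<^sub>1 \<Delta>\<^sub>1 \<or> c \<in> M\<^sub>1 \<Longrightarrow> \<epsilon> = 1"
    using condition_B_product[OF \<alpha> \<beta> Z c] by metis
  define s where "s = t + (p + q)"
  have form: "Delta_form (\<alpha> \<otimes> \<beta>) c s" unfolding s_def by (rule Delta_form_mult) fact+
  have eq: "- \<zeta> * s = - \<zeta> * (p + q) - \<zeta> * t" by (simp add: s_def algebra_simps)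
  have le: "int (dpt c) \<le> - \<zeta> * s"
    using bound \<epsilon> eq by auto
  then have "0 \<le> - \<zeta> * s" by linarith
  then have "s \<le> 0" using zeta_pos by (simp add: mult_le_0_iff)
  moreover have "s \<noteq> 0"
  proof
    assume s: "s = 0"
    have "c \<in> M\<^sub>1" using le s Delta_formD(1)[OF c] by (intro depth_eq_0_imp) auto
    moreover have "\<alpha> \<otimes> \<beta> = c" using Delta_formD[OF form] s by simp
    ultimately have "\<epsilon> = 1" "int (dpt a) + int (dpt b) \<le> - \<zeta> * (p + q)"
      using \<epsilon>(3) bound M1_in_G1 by auto
    then show False using \<epsilon>(2) eq s by auto
  qed
  ultimately show ?thesis using neg_iff[OF form] le by simp
qed

section \<open>Products of negative elements\<close>

lemma neg_in_carrier: "neg \<alpha> \<Longrightarrow> \<alpha> \<in> carrier G"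
  unfolding negative_def using Delta_formD(4) by blast

text \<open>Inside \<open>Z\<close> the exponents of \<Delta> add; otherwise the two depth bounds
  add up to the first alternative of \<open>neg_mult_criterion\<close>.\<close>

lemma neg_mult:
  assumes "neg \<alpha>" "neg \<beta>"
  shows "neg (\<alpha> \<otimes> \<beta>)"
proof (cases "\<alpha> \<in> Z \<and> \<beta> \<in> Z")
  case True
  then obtain \<gamma> \<gamma>' and i j :: int where g: "\<gamma> \<in> G\<^sub>1" "\<gamma>' \<in> G\<^sub>1"
    "\<alpha> = \<gamma> \<otimes> \<Delta> [^] i" "\<beta> = \<gamma>' \<otimes> \<Delta> [^] j"
    by (metis Z_E)
  then have "i < 0" "j < 0" using assms neg_Z_iff by auto
  then show ?thesis
    using g neg_Z_iff[of "\<gamma> \<otimes> \<gamma>'" "i + j"] by (simp add: mult_Delta_pows G1_carrier)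
next
  case False
  obtain a p b q where ab: "Delta_form \<alpha> a p" "Delta_form \<beta> b q"
    using Delta_form_exists neg_in_carrier assms by meson
  have "int (dpt a) \<le> - \<zeta> * p" "int (dpt b) \<le> - \<zeta> * q"
    using assms neg_iff[OF ab(1)] neg_iff[OF ab(2)] by auto
  then show ?thesis
    by (intro neg_mult_criterion[OF ab False]) (simp add: algebra_simps)
qed

lemma neg_mult_G1:
  assumes "neg \<alpha>" "\<beta> \<in> G\<^sub>1"
  shows "neg (\<alpha> \<otimes> \<beta>)" "neg (\<beta> \<otimes> \<alpha>)"
proof -
  have c: "\<alpha> \<in> carrier G" "\<beta> \<in> carrier G" using assms neg_in_carrier G1_carrier by auto
  have "neg (\<alpha> \<otimes> \<beta>) \<and> neg (\<beta> \<otimes> \<alpha>)"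
  proof (cases "\<alpha> \<in> Z")
    case True
    then obtain \<gamma> and j :: int where g: "\<gamma> \<in> G\<^sub>1" "\<alpha> = \<gamma> \<otimes> \<Delta> [^] j" by (rule Z_E)
    then have "j < 0" using assms neg_Z_iff by auto
    moreover have "\<alpha> \<otimes> \<beta> = (\<gamma> \<otimes> \<beta>) \<otimes> \<Delta> [^] j" "\<beta> \<otimes> \<alpha> = (\<beta> \<otimes> \<gamma>) \<otimes> \<Delta> [^] j"
      using mult_Delta_pows[of \<gamma> \<beta> j 0] mult_Delta_pows[of \<beta> \<gamma> 0 j] g c G1_carrier by auto
    ultimately show ?thesis using neg_Z_iff g(1) assms(2) by simp
  next
    case False
    obtain a p where a: "Delta_form \<alpha> a p" using Delta_form_exists c by blast
    have depth_a: "int (dpt a) \<le> - \<zeta> * p" using assms(1) neg_iff[OF a] by simp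
    obtain m :: nat and d where d: "d \<in> M\<^sub>1" "Delta_form \<beta> (\<theta> [^] m \<otimes> d) (- int m)"
      using Delta_form_G1[OF assms(2)] by blast
    define b where "b = \<theta> [^] m \<otimes> d"
    \<comment> \<open>A product in \<open>G\<^sub>1\<close> would put \<alpha> in
      \<open>G\<^sub>1\<close>, hence in \<open>Z\<close>.\<close>
    have notin: "\<alpha> \<otimes> \<beta> \<notin> G\<^sub>1" "\<beta> \<otimes> \<alpha> \<notin> G\<^sub>1"
    proof -
      have "\<alpha> \<otimes> \<beta> \<otimes> inv \<beta> = \<alpha>" "inv \<beta> \<otimes> (\<beta> \<otimes> \<alpha>) = \<alpha>"
        using c by (simp add: m_assoc, simp add: m_assoc[symmetric])
      moreover have "\<alpha> \<notin> G\<^sub>1" using False G1_subset_Z by blast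
      ultimately show "\<alpha> \<otimes> \<beta> \<notin> G\<^sub>1" "\<beta> \<otimes> \<alpha> \<notin> G\<^sub>1"
        using G1.m_closed G1.m_inv_closed[OF assms(2)] by metis+
    qed
    \<comment> \<open>For \<open>m > 0\<close> the depth of \<open>b\<close> exceeds the bound by
      exactly one, but then \<open>b\<close> lies in \<Theta>. The second alternative of
      \<open>neg_mult_criterion\<close> is made for this: the forced correction \<epsilon> = 1
      absorbs the excess.\<close>
    have "int (dpt b) \<le> - \<zeta> * - int m \<or>
        int (dpt b) \<le> - \<zeta> * - int m + 1 \<and> b \<in> Theta G \<Delta> M\<^sub>1 \<Delta>\<^sub>1"
    proof (cases "m = 0")
      case True
      then show ?thesis using d(1) depth_parabolic by (simp add: b_def)
    next
      case False
      have "b \<in> Theta G \<Delta> M\<^sub>1 \<Delta>\<^sub>1"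
        unfolding Theta_def b_def \<theta>_def[symmetric] using d(1) False
        by (auto simp: int_pow_int intro!: exI[of _ "int m"] exI[of _ d])
      then show ?thesis using depth_theta_pow[OF d(1) False] by (simp add: b_def)
    qed
    then have bound: "int (dpt a) + int (dpt b) \<le> - \<zeta> * (p + - int m) \<or>
        int (dpt a) + int (dpt b) \<le> - \<zeta> * (p + - int m) + 1 \<and> b \<in> Theta G \<Delta> M\<^sub>1 \<Delta>\<^sub>1"
      using depth_a by (auto simp: algebra_simps)
    have "neg (\<alpha> \<otimes> \<beta>)"
      by (rule neg_mult_criterion[OF a d(2)[folded b_def]]) (use False bound notin(1) in blast)+
    moreover have "neg (\<beta> \<otimes> \<alpha>)"
      by (rule neg_mult_criterion[OF d(2)[folded b_def] a])
        (use False bound notin(2) in \<open>auto simp: add.commute\<close>)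
    ultimately show ?thesis by blast
  qed
  then show "neg (\<alpha> \<otimes> \<beta>)" "neg (\<beta> \<otimes> \<alpha>)" by auto
qed

text \<open>With \<open>\<Delta>\<close>-forms \<open>a \<Delta>\<^sup>p\<close> and \<open>b \<Delta>\<^sup>q\<close> of \<open>\<alpha>\<close> and its inverse, \<open>a b\<close> is a power of \<open>\<Delta>\<close>, and
  Condition B with \<open>c = 1\<close> reads \<open>dpt a + dpt b = - \<zeta> p - \<zeta> q + 1\<close>.\<close>

lemma neg_inv_iff:
  assumes "\<alpha> \<in> carrier G" "\<alpha> \<notin> Z"
  shows "neg (inv \<alpha>) \<longleftrightarrow> \<not> neg \<alpha>"
proof -
  have inv: "inv \<alpha> \<notin> Z" using assms Z_inv[of "inv \<alpha>"] by auto
  obtain a p b q where ab: "Delta_form \<alpha> a p" "Delta_form (inv \<alpha>) b q"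
    using Delta_form_exists assms inv_closed by meson
  obtain c t where c: "Delta_form (a \<otimes> b) c t"
    using Delta_form_exists_M[of "a \<otimes> b"] Delta_formD(1) ab by blast
  have "Delta_form \<one> c (t + (p + q))" using Delta_form_mult[OF ab c] assms by simp
  then have c1: "c = \<one>" "t + (p + q) = 0" using Delta_form_unique Delta_form_one by blast+
  obtain \<epsilon> where "\<epsilon> \<in> {0, 1}" "int (dpt c) = int (dpt a) + int (dpt b) - \<zeta> * t - \<epsilon>"
    "a \<in> Theta G \<Delta> M\<^sub>1 \<Delta>\<^sub>1 \<or> b \<in> Theta G \<Delta> M\<^sub>1 \<Delta>\<^sub>1 \<or> c \<in> M\<^sub>1 \<Longrightarrow> \<epsilon> = 1"
    using condition_B_product[OF ab _ c] assms(2) by metis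
  then have "int (dpt a) + int (dpt b) = \<zeta> * t + 1"
    using c1(1) depth_parabolic[of \<one>] by simp
  moreover have "t = - p - q" using c1(2) by simp
  ultimately have sum: "int (dpt a) + int (dpt b) = - \<zeta> * p + - \<zeta> * q + 1"
    by (simp add: algebra_simps)
  \<comment> \<open>Outside \<open>Z\<close> the coefficient is not in \<open>M\<^sub>1\<close>, so
    its depth is positive and the depth bound alone forces a negative exponent.\<close>
  have reduce: "neg \<beta> \<longleftrightarrow> int (dpt d) \<le> - \<zeta> * r" if d: "Delta_form \<beta> d r" "\<beta> \<notin> Z" for \<beta> d r
  proof -
    have "d \<notin> M\<^sub>1" using Theta_bar_imp_Z[OF d(1)] d(2) by (auto simp: Theta_bar_def)
    then have "dpt d \<noteq> 0" using depth_eq_0_imp Delta_formD(1)[OF d(1)] by blast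
    then have "r \<le> - 1" if "int (dpt d) \<le> - \<zeta> * r"
    proof -
      have "0 < int (dpt d)" using \<open>dpt d \<noteq> 0\<close> by simp
      also note that
      finally have "\<zeta> * r < 0" by simp
      then show ?thesis using zeta_pos mult_nonneg_nonneg[of \<zeta> r] by linarith
    qed
    then show ?thesis using neg_iff[OF d(1)] by blast
  qed
  \<comment> \<open>Two integers whose sum exceeds the sum of their bounds by exactly one violate
    exactly one of the bounds.\<close>
  show ?thesis
    unfolding reduce[OF ab(1) assms(2)] reduce[OF ab(2) inv] using sum
    by (intro iffI) linarith+
qed

section \<open>Trichotomy and the Dehornoy structure\<close>

lemma trichotomy:
  assumes "\<alpha> \<in> carrier G"
  shows "neg \<alpha> \<or> neg (inv \<alpha>) \<or> \<alpha> \<in> G\<^sub>1"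
    and "\<not> (neg \<alpha> \<and> neg (inv \<alpha>))" "\<not> (neg \<alpha> \<and> \<alpha> \<in> G\<^sub>1)" "\<not> (neg (inv \<alpha>) \<and> \<alpha> \<in> G\<^sub>1)"
proof -
  \<comment> \<open>Elements of \<open>G\<^sub>1\<close> are the exponent-zero case of
    \<open>neg_Z_iff\<close>.\<close>
  have G1: "\<not> neg \<gamma>" if "\<gamma> \<in> G\<^sub>1" for \<gamma>
    using neg_Z_iff[OF that, of 0] G1_carrier[OF that] by simp
  then show "\<not> (neg \<alpha> \<and> \<alpha> \<in> G\<^sub>1)" "\<not> (neg (inv \<alpha>) \<and> \<alpha> \<in> G\<^sub>1)" by auto
  have "(neg \<alpha> \<or> neg (inv \<alpha>) \<or> \<alpha> \<in> G\<^sub>1) \<and> \<not> (neg \<alpha> \<and> neg (inv \<alpha>))"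
  proof (cases "\<alpha> \<in> Z")
    case True
    then obtain \<gamma> and j :: int where g: "\<gamma> \<in> G\<^sub>1" "\<alpha> = \<gamma> \<otimes> \<Delta> [^] j" by (rule Z_E)
    then have "neg \<alpha> \<longleftrightarrow> j < 0" "neg (inv \<alpha>) \<longleftrightarrow> - j < 0"
      using neg_Z_iff[of \<gamma> j] neg_Z_iff[of "inv \<gamma>" "- j"] by (simp_all add: inv_mult_Delta_pow G1_carrier)
    moreover have "\<alpha> \<in> G\<^sub>1" if "j = 0" using g that G1_carrier by simp
    ultimately show ?thesis by (cases j "0::int" rule: linorder_cases) auto
  next
    case False
    then show ?thesis using neg_inv_iff assms by blast
  qed
  then show "neg \<alpha> \<or> neg (inv \<alpha>) \<or> \<alpha> \<in> G\<^sub>1" "\<not> (neg \<alpha> \<and> neg (inv \<alpha>))" by auto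
qed

lemma dehornoy: "dehornoy_structure G M \<Delta> N G\<^sub>1 M\<^sub>1"
proof -
  define P where "P = {\<alpha> \<in> carrier G. neg (inv \<alpha>)}"
  have inv_P: "set_inv P = {\<alpha> \<in> carrier G. neg \<alpha>}"
  proof (intro Set.set_eqI iffI)
    fix x assume "x \<in> {\<alpha> \<in> carrier G. neg \<alpha>}"
    then have "inv x \<in> P" "x = inv (inv x)" by (auto simp: P_def)
    then show "x \<in> set_inv P" unfolding SET_INV_def by blast
  qed (auto simp: P_def SET_INV_def)
  \<comment> \<open>Inversion reverses the factors and carries closure of the negative elements over
    to \<open>P\<close>.\<close>
  have "\<alpha> \<otimes> \<beta> \<in> P" if "\<alpha> \<in> P" "\<beta> \<in> P" for \<alpha> \<beta>
    using that neg_mult by (simp add: P_def inv_mult_group)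
  then have "P <#> P \<subseteq> P" by (auto simp: set_mult_def)
  moreover have "g \<otimes> \<alpha> \<otimes> h \<in> P" if "g \<in> G\<^sub>1" "\<alpha> \<in> P" "h \<in> G\<^sub>1" for g \<alpha> h
    using that neg_mult_G1 G1_carrier by (simp add: P_def inv_mult_group)
  then have "G\<^sub>1 <#> P <#> G\<^sub>1 \<subseteq> P" by (auto simp: set_mult_def)
  moreover have "carrier G = P \<union> set_inv P \<union> G\<^sub>1"
    unfolding inv_P using trichotomy(1) G1_carrier by (auto simp: P_def)
  moreover have "P \<inter> set_inv P = {}" "P \<inter> G\<^sub>1 = {}" "set_inv P \<inter> G\<^sub>1 = {}"
    unfolding inv_P unfolding P_def using trichotomy(2-4) by blast+
  ultimately show ?thesis
    unfolding dehornoy_structure_def positives_def P_def[symmetric] Let_def by blast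
qed

end

theorem theorem3p2:
  fixes G :: "('a, 'b) monoid_scheme"
    and M H N G\<^sub>1 M\<^sub>1 :: "'a set"
    and \<Delta> \<Lambda> \<Delta>\<^sub>1 :: 'a
  assumes "garside_structure G M \<Delta>"
    and "parabolic_substructure G M \<Delta> H N \<Lambda>"
    and "parabolic_substructure G M \<Delta> G\<^sub>1 M\<^sub>1 \<Delta>\<^sub>1"
    and "N \<noteq> M"
    and "M\<^sub>1 \<noteq> M"
    and "monoid_span G (N \<union> M\<^sub>1) = M"
    and "\<forall>g\<in>carrier G. g \<otimes>\<^bsub>G\<^esub> \<Delta> = \<Delta> \<otimes>\<^bsub>G\<^esub> g"
    and "\<forall>g\<in>G\<^sub>1. g \<otimes>\<^bsub>G\<^esub> \<Delta>\<^sub>1 = \<Delta>\<^sub>1 \<otimes>\<^bsub>G\<^esub> g"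
    and "\<exists>\<zeta>::int. \<zeta> \<ge> 1 \<and> condition_A G M \<Delta> N M\<^sub>1 \<zeta> \<and> condition_B G M \<Delta> N M\<^sub>1 \<Delta>\<^sub>1 \<zeta>"
  shows "dehornoy_structure G M \<Delta> N G\<^sub>1 M\<^sub>1"
proof -
  obtain \<zeta> :: int where \<zeta>: "\<zeta> \<ge> 1" "condition_A G M \<Delta> N M\<^sub>1 \<zeta>" "condition_B G M \<Delta> N M\<^sub>1 \<Delta>\<^sub>1 \<zeta>"
    using assms(9) by blast
  have "parabolic G M \<Delta> N \<Lambda>" "parabolic G M \<Delta> M\<^sub>1 \<Delta>\<^sub>1"
    using assms(1-3) unfolding parabolic_def parabolic_axioms_def parabolic_substructure_def by blast+
  then interpret parabolic_pair G M \<Delta> N \<Lambda> M\<^sub>1 \<Delta>\<^sub>1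
    using assms(1,6) by (simp add: parabolic_pair_def parabolic_pair_axioms_def)
  interpret central_parabolic_pair G M \<Delta> N \<Lambda> M\<^sub>1 \<Delta>\<^sub>1 G\<^sub>1 \<zeta>
    by standard (use assms(3,5,7,8) \<zeta> in \<open>unfold parabolic_substructure_def, blast+\<close>)
  show ?thesis by (rule dehornoy)
qed

end
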